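(* Let $d\ge2$, $R\ge1$ and $n\ge2$ be integers/reals as indicated, let $C\subseteq\mathbb{R}^d$ be a bounded $R$-fat Borel set, let $m:=\lceil n^{1/d}\rceil$ (the smallest integer with $n\le m^d$), and let $S$ be the family of all $mR$-fat Borel subsets of $\mathbb{R}^d$. Then $\mathrm{PropEF}(C,n,S)=1/n$.
   Context: For $R\ge1$, a $d$-dimensional piece (Borel subset of $\mathbb{R}^d$) is $R$-fat if it contains a $d$-dimensional cube $B^-$ and is contained in a $d$-dimensional cube $B^+$ parallel to $B^-$ with $\mathrm{len}(B^+)/\mathrm{len}(B^-)\le R$ (len = side length). A value measure on $C$ is $V(X)=\int_X v$ with $v$ non-negative, bounded, integrable on $C$, $V(C)<\infty$; $V^S(X):=\sup\{V(s):s\in S,s\subseteq X\}$. For $n$ agents with value measures $V_1,\dots,V_n$, an $S$-allocation is $(X_1,\dots,X_n)$ with $X_i\in S$ pairwise disjoint and $\bigcup_i X_i\subseteq C$; it is envy-free if $V_i^S(X_i)\ge V_i^S(X_j)$ for all $i,j$. $\mathrm{PropEF}(C,n,S):=\inf_{V_1,\dots,V_n}\sup_X\min_i V_i(X_i)/V_i(C)$, the infimum over all $n$-tuples of value measures on $C$ and the supremum over envy-free $S$-allocations. *)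

theory Defs
  imports "HOL-Analysis.Analysis"
begin

definition cube :: "(real^'d \<Rightarrow> real^'d) \<Rightarrow> real^'d \<Rightarrow> real \<Rightarrow> (real^'d) set" where
  "cube Q c l = (\<lambda>x. c + Q x) ` {x. \<forall>i. 0 \<le> x $ i \<and> x $ i \<le> l}"

definition fat :: "real \<Rightarrow> (real^'d) set \<Rightarrow> bool" where
  "fat R X \<longleftrightarrow> (\<exists>Q a b l1 l2. orthogonal_transformation Q \<and> 0 < l1 \<and>
      cube Q a l1 \<subseteq> X \<and> X \<subseteq> cube Q b l2 \<and> l2 / l1 \<le> R)"

definition val :: "(real^'d \<Rightarrow> real) \<Rightarrow> (real^'d) set \<Rightarrow> real" where
  "val v X = (LINT x:X|lborel. v x)"

text \<open>Density of a value measure on C (with positive total value, so that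
  the normalised ratio V(X)/V(C) makes sense).\<close>
definition value_measure :: "(real^'d) set \<Rightarrow> (real^'d \<Rightarrow> real) \<Rightarrow> bool" where
  "value_measure C v \<longleftrightarrow> (\<forall>x\<in>C. 0 \<le> v x) \<and> (\<exists>B. \<forall>x\<in>C. v x \<le> B)
      \<and> set_integrable lborel C v \<and> 0 < val v C"

definition valS :: "(real^'d) set set \<Rightarrow> (real^'d \<Rightarrow> real) \<Rightarrow> (real^'d) set \<Rightarrow> real" where
  "valS S v X = Sup {val v s | s. s \<in> S \<and> s \<subseteq> X}"

definition S_allocation :: "(real^'d) set \<Rightarrow> nat \<Rightarrow> (real^'d) set set \<Rightarrow> (nat \<Rightarrow> (real^'d) set) \<Rightarrow> bool" where
  "S_allocation C n S X \<longleftrightarrow> (\<forall>i<n. X i \<in> S) \<and>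
     (\<forall>i<n. \<forall>j<n. i \<noteq> j \<longrightarrow> X i \<inter> X j = {}) \<and> (\<Union>i<n. X i) \<subseteq> C"

definition envy_free :: "nat \<Rightarrow> (real^'d) set set \<Rightarrow> (nat \<Rightarrow> real^'d \<Rightarrow> real) \<Rightarrow> (nat \<Rightarrow> (real^'d) set) \<Rightarrow> bool" where
  "envy_free n S v X \<longleftrightarrow> (\<forall>i<n. \<forall>j<n. valS S (v i) (X j) \<le> valS S (v i) (X i))"

text \<open>PropEF, valued in the extended reals (Sup of the empty set is -\<infinity>).\<close>
definition PropEF :: "(real^'d) set \<Rightarrow> nat \<Rightarrow> (real^'d) set set \<Rightarrow> ereal" where
  "PropEF C n S = (INF v \<in> {v. \<forall>i<n. value_measure C (v i)}.
      SUP X \<in> {X. S_allocation C n S X \<and> envy_free n S v X}.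
        ereal (Min ((\<lambda>i. val (v i) (X i) / val (v i) C) ` {..<n})))"

end

(*
Upper bound: if all densities are 1, the values of disjoint pieces sum to at most V(C).

Lower bound: a piece containing one of the m^d grid cells of the inner cube and contained in the
outer cube is mR-fat, and so is every cube.  Choose n grid cells.  For x in the standard simplex,
piece j is a cube centred in the j-th cell, which grows with x_j and fills the cell at
x_j = 1/(2n); all the rest of C is cut by parallel hyperplanes and given to the pieces with
x_j > 1/(2n), in proportion to x_j - 1/(2n).  So every piece with x_j > 0 is mR-fat, the piece
with x_j = 0 is null, and the values depend continuously on x.  Gale's rainbow version of the
KKM theorem then yields an x and a bijection giving every agent a most valuable piece.
*)
theory Submission
  imports Defs
begin

section \<open>Coverings of the simplex\<close>

text \<open>Every allotted piece lies in \<open>S\<close> and inside \<open>C\<close>, so it attains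
  its own supremum \<open>valS\<close>; envy-freeness therefore reduces to comparing integrals.
  Proportionality needs no separate argument: the pieces cover the set \<open>K\<close> that is
  divided, so a favourite piece is worth at least 1/n of \<open>K\<close>. The obstacle is that
  closed grid cells touch. Cells and outer cube are therefore contracted by a factor 1 - \<epsilon>,
  which makes \<open>K\<close> slightly smaller than \<open>C\<close>, and the shares reach only c/n
  for each c < 1. Since \<open>PropEF\<close> takes a supremum over allocations, this is enough. The
  covering theorem speaks of value functions instead of closed sets; the sets of the classical form
  are those where one piece is maximal for an agent, and they avoid the opposite face because some
  piece always has value bounded below by a positive constant.\<close>

lemma tendsto_fun_componentwise:
  fixes f :: "'a \<Rightarrow> 'i \<Rightarrow> 'b::topological_space"
  shows "(f \<longlongrightarrow> l) F \<longleftrightarrow> (\<forall>i. ((\<lambda>x. f x i) \<longlongrightarrow> l i) F)"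
  using limitin_componentwise[of "\<lambda>_. euclidean" UNIV f l F]
  by (simp add: euclidean_product_topology)

text \<open>The dimension \<open>n\<close> is a term, so points are functions; pinning the
  coordinates from \<open>n\<close> on to 0 makes the set compact in the product topology.\<close>

definition unit_cube :: "nat \<Rightarrow> (nat \<Rightarrow> real) set" where
  "unit_cube n = {x. (\<forall>i<n. 0 \<le> x i \<and> x i \<le> 1) \<and> (\<forall>i\<ge>n. x i = 0)}"

definition std_simplex :: "nat \<Rightarrow> (nat \<Rightarrow> real) set" where
  "std_simplex n = {x. (\<forall>i<n. 0 \<le> x i) \<and> (\<forall>i\<ge>n. x i = 0) \<and> (\<Sum>i<n. x i) = 1}"

lemma compact_unit_cube: "compact (unit_cube n)"
proof -
  have "unit_cube n = (\<Pi>\<^sub>E i\<in>UNIV. if i < n then {0..1} else {0})"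
    by (force simp: unit_cube_def PiE_def Pi_def not_less split: if_splits)
  moreover have "compactin (product_topology (\<lambda>_. euclidean) UNIV)
      (\<Pi>\<^sub>E i\<in>UNIV. if i < n then {0..1} else {0::real})"
    by (subst compactin_PiE) auto
  ultimately show ?thesis
    by (simp add: euclidean_product_topology)
qed

lemma std_simplex_subset_unit_cube: "std_simplex n \<subseteq> unit_cube n"
proof
  fix x assume x: "x \<in> std_simplex n"
  have "x i \<le> 1" if "i < n" for i
    using member_le_sum[of i "{..<n}" x] x that by (auto simp: std_simplex_def)
  then show "x \<in> unit_cube n"
    using x by (auto simp: std_simplex_def unit_cube_def)
qed

lemma continuous_on_coordinate [continuous_intros]:
  "continuous_on S (\<lambda>x::'i \<Rightarrow> 'a::topological_space. x i)"
  by (rule continuous_on_product_then_coordinatewise[OF continuous_on_id])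

lemma compact_std_simplex: "compact (std_simplex n)"
proof -
  have "closed {x::nat \<Rightarrow> real. (\<Sum>i<n. x i) = 1}"
    by (intro closed_Collect_eq continuous_intros)
  then have "compact (unit_cube n \<inter> {x. (\<Sum>i<n. x i) = 1})"
    by (rule compact_Int_closed[OF compact_unit_cube])
  moreover have "std_simplex n = unit_cube n \<inter> {x. (\<Sum>i<n. x i) = 1}"
    using std_simplex_subset_unit_cube[of n] by (auto simp: std_simplex_def unit_cube_def)
  ultimately show ?thesis
    by simp
qed

text \<open>Grid points are labelled in each direction by the sign of \<open>g\<close>. Kuhn's lemma
  yields, at every mesh size, a small cell on which each label takes both values; a limit point of
  these cells is a common zero by continuity.\<close>

lemma poincare_miranda:
  fixes g :: "(nat \<Rightarrow> real) \<Rightarrow> nat \<Rightarrow> real"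
  assumes cont: "\<And>i. i < n \<Longrightarrow> continuous_on (unit_cube n) (\<lambda>x. g x i)"
    and low: "\<And>x i. x \<in> unit_cube n \<Longrightarrow> i < n \<Longrightarrow> x i = 0 \<Longrightarrow> 0 \<le> g x i"
    and high: "\<And>x i. x \<in> unit_cube n \<Longrightarrow> i < n \<Longrightarrow> x i = 1 \<Longrightarrow> g x i \<le> 0"
  shows "\<exists>x\<in>unit_cube n. \<forall>i<n. g x i = 0"
proof -
  have approx: "\<exists>y\<in>unit_cube n. \<forall>i. i < n \<longrightarrow> (\<exists>a b. a \<in> unit_cube n \<and> b \<in> unit_cube n \<and>
      (\<forall>j. \<bar>a j - y j\<bar> \<le> 1 / real (Suc t)) \<and> (\<forall>j. \<bar>b j - y j\<bar> \<le> 1 / real (Suc t)) \<and>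
      0 \<le> g a i \<and> g b i \<le> 0)" for t
  proof -
    define p where "p = Suc t"
    define pt :: "(nat \<Rightarrow> nat) \<Rightarrow> nat \<Rightarrow> real"
      where "pt = (\<lambda>x j. if j < n then real (x j) / real p else 0)"
    \<comment> \<open>The first two branches force the labels that \<open>kuhn_lemma\<close> demands
      on the faces; by \<open>low\<close> and \<open>high\<close> a label still records a weak sign
      of \<open>g\<close> there.\<close>
    define label :: "(nat \<Rightarrow> nat) \<Rightarrow> nat \<Rightarrow> nat"
      where "label = (\<lambda>x i. if x i = 0 then 0 else if x i = p then 1
                          else if 0 \<le> g (pt x) i then 0 else 1)"
    have p: "0 < p"
      by (simp add: p_def)
    have pt_cube: "pt x \<in> unit_cube n" if "\<forall>i<n. x i \<le> p" for x
      using that p by (auto simp: pt_def unit_cube_def)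
    have lab: "0 \<le> g (pt x) i" if "\<forall>i<n. x i \<le> p" "i < n" "label x i = 0" for x i
      using that low[OF pt_cube[OF that(1)] that(2)] by (auto simp: label_def pt_def split: if_splits)
    have lab': "g (pt x) i \<le> 0" if "\<forall>i<n. x i \<le> p" "i < n" "label x i \<noteq> 0" for x i
      using that high[OF pt_cube[OF that(1)] that(2)] p
      by (auto simp: label_def pt_def split: if_splits)
    obtain q where q: "\<forall>i<n. q i < p"
      and ex: "\<forall>i<n. \<exists>r s. (\<forall>j<n. q j \<le> r j \<and> r j \<le> q j + 1) \<and>
          (\<forall>j<n. q j \<le> s j \<and> s j \<le> q j + 1) \<and> label r i \<noteq> label s i"
      by (rule kuhn_lemma[of p n label]) (use p in \<open>auto simp: label_def\<close>)
    have close: "\<bar>pt r j - pt q j\<bar> \<le> 1 / real (Suc t)" if "\<forall>j<n. q j \<le> r j \<and> r j \<le> q j + 1" for r j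
    proof (cases "j < n")
      case True
      then have "q j \<le> r j" "r j \<le> q j + 1"
        using that by auto
      then have "\<bar>real (r j) - real (q j)\<bar> \<le> 1"
        by linarith
      then have "\<bar>real (r j) - real (q j)\<bar> / real p \<le> 1 / real p"
        by (simp add: divide_right_mono)
      then show ?thesis
        using True by (simp add: pt_def p_def flip: diff_divide_distrib)
    qed (simp add: pt_def)
    show ?thesis
    proof (intro bexI[of _ "pt q"] allI impI)
      show "pt q \<in> unit_cube n"
        using q by (intro pt_cube) (auto simp: less_imp_le)
      fix i assume i: "i < n"
      with ex obtain r s where r: "\<forall>j<n. q j \<le> r j \<and> r j \<le> q j + 1"
        and s: "\<forall>j<n. q j \<le> s j \<and> s j \<le> q j + 1" and ne: "label r i \<noteq> label s i"
        by blast
      have le: "\<forall>j<n. r j \<le> p" "\<forall>j<n. s j \<le> p"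
        using r s q by (fastforce intro: order_trans[OF _ Suc_leI])+
      note facts = r s le[THEN pt_cube] close
      show "\<exists>a b. a \<in> unit_cube n \<and> b \<in> unit_cube n \<and>
          (\<forall>j. \<bar>a j - pt q j\<bar> \<le> 1 / real (Suc t)) \<and> (\<forall>j. \<bar>b j - pt q j\<bar> \<le> 1 / real (Suc t)) \<and>
          0 \<le> g a i \<and> g b i \<le> 0"
      proof (cases "label r i = 0")
        case True
        then show ?thesis
          using facts lab[OF le(1) i True] lab'[OF le(2) i] ne
          by (intro exI[of _ "pt r"] exI[of _ "pt s"]) auto
      next
        case False
        then have "label s i = 0"
          using ne by (auto simp: label_def split: if_splits)
        then show ?thesis
          using facts lab'[OF le(1) i False] lab[OF le(2) i]
          by (intro exI[of _ "pt s"] exI[of _ "pt r"]) auto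
      qed
    qed
  qed
  then obtain y where y: "\<And>t. y t \<in> unit_cube n"
    and ex: "\<And>t i. i < n \<Longrightarrow> \<exists>a b. a \<in> unit_cube n \<and> b \<in> unit_cube n \<and>
      (\<forall>j. \<bar>a j - y t j\<bar> \<le> 1 / real (Suc t)) \<and> (\<forall>j. \<bar>b j - y t j\<bar> \<le> 1 / real (Suc t)) \<and>
      0 \<le> g a i \<and> g b i \<le> 0"
    by metis
  obtain x r where x: "x \<in> unit_cube n" and r: "strict_mono r" and lim: "(y \<circ> r) \<longlonglongrightarrow> x"
    using compact_unit_cube y unfolding compact_def by metis
  have near: "(\<lambda>t. a (r t)) \<longlonglongrightarrow> x" if "\<And>t j. \<bar>a t j - y t j\<bar> \<le> 1 / real (Suc t)" for a
    unfolding tendsto_fun_componentwise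
  proof
    fix j
    have "(\<lambda>t. a (r t) j - y (r t) j) \<longlonglongrightarrow> 0"
    proof (rule Lim_null_comparison)
      show "\<forall>\<^sub>F t in sequentially. norm (a (r t) j - y (r t) j) \<le> 1 / real (Suc (r t))"
        using that by (intro always_eventually allI) (simp del: of_nat_Suc)
      show "(\<lambda>t. 1 / real (Suc (r t))) \<longlonglongrightarrow> 0"
        using LIMSEQ_subseq_LIMSEQ[OF LIMSEQ_Suc[OF lim_1_over_n[where 'a=real]] r]
        by (simp add: o_def)
    qed
    moreover have "(\<lambda>t. y (r t) j) \<longlonglongrightarrow> x j"
      using lim by (simp add: tendsto_fun_componentwise o_def)
    ultimately have "(\<lambda>t. (a (r t) j - y (r t) j) + y (r t) j) \<longlonglongrightarrow> 0 + x j"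
      by (rule tendsto_add)
    then show "(\<lambda>t. a (r t) j) \<longlonglongrightarrow> x j"
      by simp
  qed
  have "g x i = 0" if i: "i < n" for i
  proof -
    obtain a b where ab: "\<And>t. a t \<in> unit_cube n" "\<And>t. b t \<in> unit_cube n"
      "\<And>t j. \<bar>a t j - y t j\<bar> \<le> 1 / real (Suc t)" "\<And>t j. \<bar>b t j - y t j\<bar> \<le> 1 / real (Suc t)"
      and g: "\<And>t. 0 \<le> g (a t) i" "\<And>t. g (b t) i \<le> 0"
      using ex[OF i] by metis
    have "(\<lambda>t. g (a (r t)) i) \<longlonglongrightarrow> g x i" "(\<lambda>t. g (b (r t)) i) \<longlonglongrightarrow> g x i"
      using ab cont[OF i] x near
      by (auto intro!: continuous_on_tendsto_compose[where f = "\<lambda>x. g x i"])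
    then show ?thesis
      using g by (meson LIMSEQ_le_const LIMSEQ_le_const2 antisym)
  qed
  with x show ?thesis
    by blast
qed

text \<open>A degree argument in disguise: the condition on the faces controls \<open>f\<close> on
  the boundary so far that it cannot miss the barycentre. A retraction brings the simplex under the
  theorem for the cube.\<close>

lemma std_simplex_hits_barycentre:
  fixes f :: "(nat \<Rightarrow> real) \<Rightarrow> nat \<Rightarrow> real"
  assumes n: "0 < n"
    and cont: "\<And>j. j < n \<Longrightarrow> continuous_on (std_simplex n) (\<lambda>x. f x j)"
    and sum: "\<And>x. x \<in> std_simplex n \<Longrightarrow> (\<Sum>j<n. f x j) = 1"
    and face: "\<And>x j. x \<in> std_simplex n \<Longrightarrow> j < n \<Longrightarrow> x j = 0 \<Longrightarrow> f x j = 0"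
  shows "\<exists>x\<in>std_simplex n. \<forall>j<n. f x j = 1 / real n"
proof -
  \<comment> \<open>\<open>r\<close> retracts the cube onto the simplex: it spreads a shortfall of
    the coordinate sum evenly and rescales an excess. \<open>d\<close> records how far each
    coordinate of \<open>f\<close> falls below 1/n.\<close>
  define r :: "(nat \<Rightarrow> real) \<Rightarrow> nat \<Rightarrow> real"
    where "r = (\<lambda>y j. if j < n then (y j + max 0 (1 - (\<Sum>k<n. y k)) / n) / max 1 (\<Sum>k<n. y k) else 0)"
  define d where "d = (\<lambda>y j. max 0 (1 / n - f (r y) j))"
  txt \<open>At a zero of \<open>d y j - y j * (\<Sum>k<n. d y k)\<close> either all \<open>d y j\<close> vanish, or summing over \<open>j\<close>
    gives \<open>(\<Sum>k<n. y k) = 1\<close>, so that \<open>r y = y\<close> and the face condition forces \<open>d y j > 0\<close> for all \<open>j\<close>.\<close>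
  have r: "r y \<in> std_simplex n" if "y \<in> unit_cube n" for y
  proof -
    have "(\<Sum>j<n. r y j) = ((\<Sum>j<n. y j) + max 0 (1 - (\<Sum>k<n. y k))) / max 1 (\<Sum>k<n. y k)"
      using n by (simp add: r_def sum.distrib flip: sum_divide_distrib)
    also have "\<dots> = 1"
      by (auto simp: max_def)
    finally show ?thesis
      using that by (auto simp: std_simplex_def unit_cube_def r_def)
  qed
  have cont_r: "continuous_on (unit_cube n) r"
  proof (rule continuous_on_coordinatewise_then_product)
    fix j
    show "continuous_on (unit_cube n) (\<lambda>y. r y j)"
      by (cases "j < n") (auto simp: r_def n intro!: continuous_intros)
  qed
  have cont_d: "continuous_on (unit_cube n) (\<lambda>y. d y j)" if "j < n" for j
    unfolding d_def using r
    by (intro continuous_intros continuous_on_compose2[OF cont[OF that] cont_r]) auto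
  have "\<exists>y\<in>unit_cube n. \<forall>j<n. d y j - y j * (\<Sum>k<n. d y k) = 0"
  proof (rule poincare_miranda)
    show "continuous_on (unit_cube n) (\<lambda>y. d y i - y i * (\<Sum>k<n. d y k))" if "i < n" for i
      using that by (intro continuous_intros cont_d) auto
    show "0 \<le> d x i - x i * (\<Sum>k<n. d x k)" if "x i = 0" for x i
      using that by (simp add: d_def)
    show "d x i - x i * (\<Sum>k<n. d x k) \<le> 0" if "x i = 1" "i < n" for x i
      using that member_le_sum[of i "{..<n}" "d x"] by (simp add: d_def)
  qed
  then obtain y where y: "y \<in> unit_cube n" and eq: "\<And>j. j < n \<Longrightarrow> d y j = y j * (\<Sum>k<n. d y k)"
    by auto
  define s where "s = (\<Sum>k<n. d y k)"
  have d0: "0 \<le> d y j" for j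
    by (simp add: d_def)
  have "s = 0"
  proof (rule ccontr)
    assume "s \<noteq> 0"
    moreover have "0 \<le> s"
      unfolding s_def by (intro sum_nonneg d0)
    ultimately have s: "0 < s"
      by simp
    have "s = (\<Sum>j<n. y j) * s"
      unfolding s_def sum_distrib_right by (rule sum.cong) (auto simp: eq)
    then have y1: "(\<Sum>j<n. y j) = 1"
      using s by simp
    then have ry: "r y = y"
      using y by (auto simp: r_def unit_cube_def)
    have "f y j < 1 / n" if j: "j < n" for j
    proof -
      have "y j \<noteq> 0"
        using eq[OF j] face[of y j] r[OF y] j n by (auto simp: d_def ry)
      then have "0 < d y j"
        using eq[OF j] s y j by (auto simp: unit_cube_def s_def[symmetric] less_le)
      then show ?thesis
        by (simp add: d_def ry)
    qed
    then have "(\<Sum>j<n. f y j) < (\<Sum>j<n. 1 / n)"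
      using n by (intro sum_strict_mono) auto
    then show False
      using sum[of y] r[OF y] n by (simp add: ry)
  qed
  then have ge: "1 / n \<le> f (r y) j" if "j < n" for j
    using that eq[OF that] by (simp add: s_def d_def)
  have "f (r y) j = 1 / n" if j: "j < n" for j
  proof (rule ccontr)
    assume "f (r y) j \<noteq> 1 / n"
    then have "(\<Sum>k<n. 1 / n) < (\<Sum>k<n. f (r y) k)"
      using ge ge[OF j] j by (intro sum_strict_mono_ex1) (auto intro!: bexI[of _ j] simp: less_le)
    then show False
      using sum[OF r[OF y]] n by simp
  qed
  with r[OF y] show ?thesis
    by blast
qed

section \<open>Hall's theorem and doubly stochastic matrices\<close>

lemma hall_marriage:
  fixes A :: "'a \<Rightarrow> 'b set"
  assumes "finite I" and "\<And>i. i \<in> I \<Longrightarrow> finite (A i)"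
    and "\<And>J. J \<subseteq> I \<Longrightarrow> card J \<le> card (\<Union> (A ` J))"
  shows "\<exists>f. inj_on f I \<and> (\<forall>i\<in>I. f i \<in> A i)"
  using assms
proof (induction I arbitrary: A rule: finite_psubset_induct)
  case (psubset I)
  note fin = psubset.prems(1) and hall = psubset.prems(2)
  have finU: "finite (\<Union> (A ` J))" if "J \<subseteq> I" for J
    using that fin psubset.hyps by (auto intro: finite_subset)
  show ?case
  proof (cases "I = {}")
    case True
    then show ?thesis by simp
  next
    case ne: False
    \<comment> \<open>If some proper nonempty \<open>J\<close> has exactly \<open>card J\<close>
      candidates, \<open>J\<close> uses them all up and the rest is matched outside them. Otherwise
      every proper nonempty subset has a candidate to spare, and any single pair may be
      fixed.\<close>
    show ?thesis
    proof (cases "\<exists>J. J \<subset> I \<and> J \<noteq> {} \<and> card (\<Union> (A ` J)) = card J")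
      case True
      then obtain J where J: "J \<subset> I" "J \<noteq> {}" and tight: "card (\<Union> (A ` J)) = card J"
        by blast
      define U where "U = \<Union> (A ` J)"
      have finJ: "finite J"
        using J psubset.hyps by (auto intro: finite_subset)
      have "\<exists>f. inj_on f J \<and> (\<forall>i\<in>J. f i \<in> A i)"
        using J fin by (intro psubset.IH hall) auto
      then obtain f where f: "inj_on f J" "\<And>i. i \<in> J \<Longrightarrow> f i \<in> A i"
        by blast
      have "\<exists>g. inj_on g (I - J) \<and> (\<forall>i\<in>I - J. g i \<in> A i - U)"
      proof (rule psubset.IH)
        show "I - J \<subset> I"
          using J by blast
        show "finite (A i - U)" if "i \<in> I - J" for i
          using that fin by simp
        fix L assume L: "L \<subseteq> I - J"
        have finL: "finite L"
          using L psubset.hyps by (auto intro: finite_subset)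
        have un: "\<Union> (A ` (J \<union> L)) = U \<union> (\<Union>i\<in>L. A i - U)"
          by (auto simp: U_def)
        have "card J + card L = card (J \<union> L)"
          using finJ finL L by (intro card_Un_disjoint[symmetric]) auto
        also have "\<dots> \<le> card (\<Union> (A ` (J \<union> L)))"
          using J L by (intro hall) auto
        also have "\<dots> \<le> card U + card (\<Union>i\<in>L. A i - U)"
          unfolding un by (rule card_Un_le)
        finally show "card L \<le> card (\<Union>i\<in>L. A i - U)"
          using tight by (simp add: U_def)
      qed
      then obtain g where g: "inj_on g (I - J)" "\<And>i. i \<in> I - J \<Longrightarrow> g i \<in> A i - U"
        by blast
      have "inj_on (\<lambda>i. if i \<in> J then f i else g i) I"
      proof (rule inj_onI)
        fix x y assume "x \<in> I" "y \<in> I" "(if x \<in> J then f x else g x) = (if y \<in> J then f y else g y)"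
        then show "x = y"
          using f(2)[of x] f(2)[of y] g(2)[of x] g(2)[of y] inj_onD[OF f(1), of x y] inj_onD[OF g(1), of x y]
          by (auto simp: U_def split: if_splits)
      qed
      then show ?thesis
        using f g by (intro exI[of _ "\<lambda>i. if i \<in> J then f i else g i"]) auto
    next
      case False
      obtain i where i: "i \<in> I"
        using ne by blast
      have "A i \<noteq> {}"
        using hall[of "{i}"] i by auto
      then obtain y where y: "y \<in> A i"
        by blast
      have "\<exists>g. inj_on g (I - {i}) \<and> (\<forall>k\<in>I - {i}. g k \<in> A k - {y})"
      proof (rule psubset.IH)
        show "I - {i} \<subset> I"
          using i by blast
        show "finite (A k - {y})" if "k \<in> I - {i}" for k
          using that fin by simp
        fix L assume L: "L \<subseteq> I - {i}"
        show "card L \<le> card (\<Union>k\<in>L. A k - {y})"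
        proof (cases "L = {}")
          case nonempty: False
          then have "card L < card (\<Union> (A ` L))"
            using False hall[of L] L i by (metis Diff_subset insert_Diff insert_subset le_neq_implies_less
                order.trans psubsetI subset_Diff_insert)
          moreover have "(\<Union>k\<in>L. A k - {y}) = \<Union> (A ` L) - {y}"
            by auto
          ultimately show ?thesis
            using finU[of L] L by (auto simp: card_Diff_singleton_if)
        qed simp
      qed
      then obtain g where g: "inj_on g (I - {i})" "\<And>k. k \<in> I - {i} \<Longrightarrow> g k \<in> A k - {y}"
        by blast
      define h where "h = (\<lambda>k. if k = i then y else g k)"
      have "inj_on h I"
      proof (rule inj_onI)
        fix j k assume "j \<in> I" "k \<in> I" "h j = h k"
        then show "j = k"
          using g(2)[of j] g(2)[of k] inj_onD[OF g(1), of j k] by (auto simp: h_def split: if_splits)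
      qed
      moreover have "\<forall>k\<in>I. h k \<in> A k"
        using g(2) y by (auto simp: h_def)
      ultimately show ?thesis
        by blast
    qed
  qed
qed

text \<open>The support of the matrix satisfies Hall's condition: the rows in \<open>J\<close> have
  total weight \<open>card J\<close>, all of it in the columns \<open>N\<close>, and a column
  carries only weight 1.\<close>

lemma doubly_stochastic_positive_permutation:
  fixes a :: "nat \<Rightarrow> nat \<Rightarrow> real"
  assumes nonneg: "\<And>i j. i < n \<Longrightarrow> j < n \<Longrightarrow> 0 \<le> a i j"
    and rows: "\<And>i. i < n \<Longrightarrow> (\<Sum>j<n. a i j) = 1"
    and cols: "\<And>j. j < n \<Longrightarrow> (\<Sum>i<n. a i j) = 1"
  shows "\<exists>\<pi>. \<pi> permutes {..<n} \<and> (\<forall>i<n. 0 < a i (\<pi> i))"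
proof -
  define A where "A i = {j. j < n \<and> 0 < a i j}" for i
  have "\<exists>f. inj_on f {..<n} \<and> (\<forall>i\<in>{..<n}. f i \<in> A i)"
  proof (rule hall_marriage)
    show "finite (A i)" for i
      by (simp add: A_def)
    fix J :: "nat set" assume J: "J \<subseteq> {..<n}"
    define N where "N = \<Union> (A ` J)"
    have N: "N \<subseteq> {..<n}"
      by (auto simp: N_def A_def)
    have "real (card J) = (\<Sum>i\<in>J. \<Sum>j<n. a i j)"
      using J by (simp add: rows subset_iff)
    also have "\<dots> = (\<Sum>i\<in>J. \<Sum>j\<in>N. a i j)"
    proof (rule sum.cong[OF refl])
      fix i assume i: "i \<in> J"
      have "a i j = 0" if "j \<in> {..<n} - N" for j
      proof -
        have "\<not> 0 < a i j"
          using that i by (auto simp: N_def A_def)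
        then show ?thesis
          using nonneg[of i j] subsetD[OF J i] that by simp
      qed
      then show "(\<Sum>j<n. a i j) = (\<Sum>j\<in>N. a i j)"
        using N by (intro sum.mono_neutral_right) auto
    qed
    also have "\<dots> \<le> (\<Sum>i<n. \<Sum>j\<in>N. a i j)"
      using J N nonneg by (intro sum_mono2 sum_nonneg) auto
    also have "\<dots> = (\<Sum>j\<in>N. \<Sum>i<n. a i j)"
      by (rule sum.swap)
    also have "\<dots> = real (card N)"
      using N by (simp add: cols subset_iff)
    finally show "card J \<le> card (\<Union> (A ` J))"
      by (simp add: N_def)
  qed simp
  then obtain f where f: "inj_on f {..<n}" "\<And>i. i < n \<Longrightarrow> f i \<in> A i"
    by auto
  define \<pi> where "\<pi> = (\<lambda>i. if i < n then f i else i)"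
  have inj: "inj_on \<pi> {..<n}"
    using f(1) by (auto simp: \<pi>_def inj_on_def)
  have "\<pi> ` {..<n} \<subseteq> {..<n}"
    using f(2) by (auto simp: \<pi>_def A_def)
  then have "bij_betw \<pi> {..<n} {..<n}"
    using inj by (simp add: bij_betw_def endo_inj_surj)
  then have "\<pi> permutes {..<n}"
    by (rule bij_imp_permutes) (simp add: \<pi>_def)
  moreover have "\<forall>i<n. 0 < a i (\<pi> i)"
    using f(2) by (simp add: \<pi>_def A_def)
  ultimately show ?thesis
    by blast
qed

section \<open>The rainbow covering theorem\<close>

text \<open>The weight \<open>w i j\<close> is a continuous substitute for the indicator of ``\<open>u i j\<close> is a maximal \<open>u i k\<close>''
  and still vanishes on the face \<open>x j = 0\<close>.  Where the average over \<open>i\<close> of the normalised weights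
  is the barycentre, these weights form a doubly stochastic matrix.\<close>
lemma rainbow_covering_approx:
  fixes u :: "nat \<Rightarrow> nat \<Rightarrow> (nat \<Rightarrow> real) \<Rightarrow> real"
  assumes n: "0 < n" and e: "0 < e"
    and cont: "\<And>i j. i < n \<Longrightarrow> j < n \<Longrightarrow> continuous_on (std_simplex n) (u i j)"
    and face: "\<And>x i j. x \<in> std_simplex n \<Longrightarrow> i < n \<Longrightarrow> j < n \<Longrightarrow> x j = 0 \<Longrightarrow> u i j x = 0"
    and cover: "\<And>x i. x \<in> std_simplex n \<Longrightarrow> i < n \<Longrightarrow> \<exists>j<n. e \<le> u i j x"
  shows "\<exists>x\<in>std_simplex n. \<exists>\<pi>. \<pi> permutes {..<n} \<and>
    (\<forall>i<n. (\<Sum>k<n. max 0 (u i k x - u i (\<pi> i) x)) < e)"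
proof -
  define w where "w = (\<lambda>i j x. max 0 (e - (\<Sum>k<n. max 0 (u i k x - u i j x))))"
  define f where "f = (\<lambda>i j x. w i j x / (\<Sum>l<n. w i l x))"
  have w0: "0 \<le> w i j x" for i j x
    by (simp add: w_def)
  have wpos: "0 < (\<Sum>l<n. w i l x)" for i x
  proof -
    \<comment> \<open>Nothing exceeds an agent's best piece, so its weight is the full
      \<open>e\<close>; this keeps the denominators of \<open>f\<close> positive.\<close>
    have "Max ((\<lambda>k. u i k x) ` {..<n}) \<in> (\<lambda>k. u i k x) ` {..<n}"
      using n by (intro Max_in) auto
    then obtain j where j: "j \<in> {..<n}" and "u i j x = Max ((\<lambda>k. u i k x) ` {..<n})"
      by (metis imageE)
    then have "u i k x \<le> u i j x" if "k < n" for k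
      using that by simp
    then have "(\<Sum>k<n. max 0 (u i k x - u i j x)) = 0"
      by (intro sum.neutral) auto
    then have "w i j x = e"
      using e by (simp add: w_def)
    then show ?thesis
      using member_le_sum[of j "{..<n}" "\<lambda>l. w i l x"] j w0 e by simp
  qed
  have contw: "continuous_on (std_simplex n) (w i j)" if "i < n" "j < n" for i j
    unfolding w_def using that by (intro continuous_intros cont) auto
  have contf: "continuous_on (std_simplex n) (f i j)" if "i < n" "j < n" for i j
    unfolding f_def using that wpos less_imp_neq[OF wpos]
    by (intro continuous_intros contw[unfolded eta_contract_eq]) (auto simp: less_le)
  have f0: "0 \<le> f i j x" for i j x
    using w0 wpos[of i x] by (simp add: f_def)
  have frow: "(\<Sum>j<n. f i j x) = 1" for i x
    using wpos[of i x] by (simp add: f_def flip: sum_divide_distrib)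
  \<comment> \<open>The cutoff at \<open>e\<close> is made for this: on the face
    \<open>u i j\<close> is 0 while another piece is worth at least \<open>e\<close>, so the excess
    uses up the whole weight.\<close>
  have fface: "f i j x = 0" if x: "x \<in> std_simplex n" "i < n" "j < n" "x j = 0" for i j x
  proof -
    obtain k where k: "k < n" "e \<le> u i k x"
      using cover x by blast
    then have "e \<le> max 0 (u i k x - u i j x)"
      using face[OF x] by simp
    also have "\<dots> \<le> (\<Sum>k<n. max 0 (u i k x - u i j x))"
      using k by (intro member_le_sum) auto
    finally show ?thesis
      by (simp add: f_def w_def)
  qed
  have "\<exists>x\<in>std_simplex n. \<forall>j<n. (\<Sum>i<n. f i j x) / n = 1 / n"
  proof (rule std_simplex_hits_barycentre[OF n])
    show "continuous_on (std_simplex n) (\<lambda>x. (\<Sum>i<n. f i j x) / n)" if "j < n" for j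
      using that n by (intro continuous_intros contf) auto
    show "(\<Sum>j<n. (\<Sum>i<n. f i j x) / n) = 1" for x
    proof -
      have "(\<Sum>j<n. \<Sum>i<n. f i j x) = n"
        by (subst sum.swap) (simp add: frow)
      then show ?thesis
        using n by (simp flip: sum_divide_distrib)
    qed
  qed (simp add: fface)
  then obtain x where x: "x \<in> std_simplex n" and col: "\<And>j. j < n \<Longrightarrow> (\<Sum>i<n. f i j x) = 1"
    using n by auto
  obtain \<pi> where \<pi>: "\<pi> permutes {..<n}" and pos: "\<And>i. i < n \<Longrightarrow> 0 < f i (\<pi> i) x"
    using doubly_stochastic_positive_permutation[of n "\<lambda>i j. f i j x"] f0 frow col by blast
  have "(\<Sum>k<n. max 0 (u i k x - u i (\<pi> i) x)) < e" if "i < n" for i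
    using pos[OF that] wpos[of i x] by (auto simp: f_def zero_less_divide_iff w_def max_def split: if_splits)
  with x \<pi> show ?thesis
    by blast
qed

text \<open>The permutation found approximately depends on the precision, but there are only
  finitely many permutations and the simplex is compact. If no permutation reached total excess 0,
  all total excesses would share a positive lower bound, which a fine enough approximation
  violates.\<close>

theorem rainbow_covering:
  fixes u :: "nat \<Rightarrow> nat \<Rightarrow> (nat \<Rightarrow> real) \<Rightarrow> real"
  assumes n: "0 < n" and e: "0 < e"
    and cont: "\<And>i j. i < n \<Longrightarrow> j < n \<Longrightarrow> continuous_on (std_simplex n) (u i j)"
    and face: "\<And>x i j. x \<in> std_simplex n \<Longrightarrow> i < n \<Longrightarrow> j < n \<Longrightarrow> x j = 0 \<Longrightarrow> u i j x = 0"
    and cover: "\<And>x i. x \<in> std_simplex n \<Longrightarrow> i < n \<Longrightarrow> \<exists>j<n. e \<le> u i j x"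
  shows "\<exists>x\<in>std_simplex n. \<exists>\<pi>. \<pi> permutes {..<n} \<and> (\<forall>i<n. \<forall>k<n. u i k x \<le> u i (\<pi> i) x)"
proof -
  define G where "G = (\<lambda>\<pi> x. \<Sum>i<n. \<Sum>k<n. max 0 (u i k x - u i (\<pi> i) x))"
  have G0: "0 \<le> G \<pi> x" for \<pi> x
    unfolding G_def by (intro sum_nonneg) auto
  have "\<exists>\<pi>. \<pi> permutes {..<n} \<and> (\<exists>x\<in>std_simplex n. G \<pi> x = 0)"
  proof (rule ccontr)
    assume contra: "\<not> ?thesis"
    have "\<exists>c>0. \<forall>x\<in>std_simplex n. c \<le> G \<pi> x" if \<pi>: "\<pi> permutes {..<n}" for \<pi>
    proof (cases "std_simplex n = {}")
      case False
      have "continuous_on (std_simplex n) (G \<pi>)"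
        unfolding G_def using permutes_in_image[OF \<pi>] by (intro continuous_intros cont) auto
      from continuous_attains_inf[OF compact_std_simplex False this]
      obtain x where x: "x \<in> std_simplex n" "\<forall>y\<in>std_simplex n. G \<pi> x \<le> G \<pi> y"
        by blast
      moreover have "0 < G \<pi> x"
        using contra \<pi> x G0[of \<pi> x] by (auto simp: less_le)
      ultimately show ?thesis
        by blast
    qed (auto intro: exI[of _ 1])
    then obtain c where c: "\<And>\<pi>. \<pi> permutes {..<n} \<Longrightarrow> 0 < c \<pi>"
      and cG: "\<And>\<pi> x. \<pi> permutes {..<n} \<Longrightarrow> x \<in> std_simplex n \<Longrightarrow> c \<pi> \<le> G \<pi> x"
      by metis
    define P where "P = {\<pi>. \<pi> permutes {..<n}}"
    have "finite P" "id \<in> P"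
      unfolding P_def by (simp_all add: finite_permutations permutes_id)
    then have P: "finite P" "P \<noteq> {}"
      by auto
    define m where "m = Min (c ` P)"
    \<comment> \<open>At most \<open>e\<close>, so that \<open>cover\<close> still applies, and at
      most \<open>m / n\<close>, so that \<open>n\<close> numbers below it add up to less than
      \<open>m\<close>.\<close>
    define e' where "e' = min e (m / n)"
    have m: "0 < m"
      unfolding m_def using P c by (simp add: P_def)
    have "n * e' \<le> n * (m / n)"
      unfolding e'_def by (intro mult_left_mono) auto
    then have e': "0 < e'" "e' \<le> e" "n * e' \<le> m"
      using n e m by (simp_all add: e'_def)
    have "\<exists>x\<in>std_simplex n. \<exists>\<pi>. \<pi> permutes {..<n} \<and>
        (\<forall>i<n. (\<Sum>k<n. max 0 (u i k x - u i (\<pi> i) x)) < e')"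
    proof (rule rainbow_covering_approx)
      show "\<exists>j<n. e' \<le> u i j x" if "x \<in> std_simplex n" "i < n" for x i
        using cover[OF that] e'(2) by (auto intro: order_trans)
    qed (use n e'(1) face cont in auto)
    then obtain x \<pi> where x: "x \<in> std_simplex n" and \<pi>: "\<pi> permutes {..<n}"
      and lt: "\<And>i. i < n \<Longrightarrow> (\<Sum>k<n. max 0 (u i k x - u i (\<pi> i) x)) < e'"
      by blast
    have "G \<pi> x < (\<Sum>i<n. e')"
      unfolding G_def using lt n by (intro sum_strict_mono) auto
    also have "\<dots> \<le> m"
      using e' by simp
    also have "\<dots> \<le> c \<pi>"
      unfolding m_def using P \<pi> by (simp add: P_def)
    finally show False
      using cG[OF \<pi> x] by simp
  qed
  then obtain \<pi> x where \<pi>: "\<pi> permutes {..<n}" and x: "x \<in> std_simplex n" and G: "G \<pi> x = 0"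
    by blast
  have "u i k x \<le> u i (\<pi> i) x" if ik: "i < n" "k < n" for i k
  proof -
    have "(\<Sum>k<n. max 0 (u i k x - u i (\<pi> i) x)) = 0"
      using G ik unfolding G_def by (subst (asm) sum_nonneg_eq_0_iff) (auto intro!: sum_nonneg)
    then have "max 0 (u i k x - u i (\<pi> i) x) = 0"
      using ik by (subst (asm) sum_nonneg_eq_0_iff) auto
    then show ?thesis
      by (simp add: max_def split: if_splits)
  qed
  with \<pi> x show ?thesis
    by blast
qed

section \<open>Partitions parametrised by the simplex\<close>

text \<open>The first set is a seed; it is not cut by \<open>K\<close>, so a seed that leaves
  \<open>K\<close> keeps its shape. The second is a layer of what the seeds leave of
  \<open>K\<close>, half-open so that consecutive layers are disjoint and lose no point.\<close>

definition sliced_piece ::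
    "nat \<Rightarrow> (nat \<Rightarrow> 'a \<Rightarrow> real) \<Rightarrow> 'a set \<Rightarrow> ('a \<Rightarrow> real) \<Rightarrow> (nat \<Rightarrow> real) \<Rightarrow> (nat \<Rightarrow> real) \<Rightarrow> nat \<Rightarrow> 'a set"
  where "sliced_piece n \<psi> K h s c j =
    {p. \<psi> j p \<le> s j} \<union> {p \<in> K. (\<forall>k<n. s k < \<psi> k p) \<and> c j \<le> h p \<and> h p < c (Suc j)}"

lemma sliced_piece_measurable:
  fixes \<psi> :: "nat \<Rightarrow> 'a::topological_space \<Rightarrow> real"
  assumes "\<And>k. k < n \<Longrightarrow> \<psi> k \<in> borel_measurable borel" and "h \<in> borel_measurable borel"
    and "K \<in> sets borel" and "j < n"
  shows "sliced_piece n \<psi> K h s c j \<in> sets borel"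
proof -
  have 1: "{p. \<psi> j p \<le> s j} \<in> sets borel"
    using assms by simp
  have "{p \<in> space borel. \<forall>k\<in>{..<n}. s k < \<psi> k p} \<in> sets borel"
    using assms by (intro sets.sets_Collect_finite_All') auto
  then have 2: "{p. \<forall>k\<in>{..<n}. s k < \<psi> k p} \<in> sets borel"
    by simp
  have 3: "{p. c j \<le> h p} \<in> sets borel" "{p. h p < c (Suc j)} \<in> sets borel"
    using assms by simp_all
  have "sliced_piece n \<psi> K h s c j = {p. \<psi> j p \<le> s j} \<union>
      (K \<inter> {p. \<forall>k\<in>{..<n}. s k < \<psi> k p} \<inter> {p. c j \<le> h p} \<inter> {p. h p < c (Suc j)})"
    by (auto simp: sliced_piece_def)
  also have "\<dots> \<in> sets borel"
    using 1 2 3 assms by (intro sets.Un sets.Int)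
  finally show ?thesis .
qed

lemma eventually_less_iff_limit:
  fixes a :: "nat \<Rightarrow> real"
  assumes "a \<longlonglongrightarrow> l" and "l \<noteq> b"
  shows "\<forall>\<^sub>F t in sequentially. (a t < b \<longleftrightarrow> l < b) \<and> (a t \<le> b \<longleftrightarrow> l \<le> b)"
proof (cases "l < b")
  case True
  then show ?thesis
    using order_tendstoD(2)[OF assms(1) True] by (auto elim!: eventually_mono)
next
  case False
  then show ?thesis
    using order_tendstoD(1)[OF assms(1), of b] assms(2) by (auto elim!: eventually_mono)
qed

text \<open>Membership of \<open>p\<close> is eventually constant unless \<open>p\<close> lies on a
  limiting level set of some \<open>\<psi> k\<close> or of \<open>h\<close>. These are null, so
  dominated convergence with bound \<open>\<bar>f p\<bar>\<close> applies.\<close>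

lemma sliced_piece_integral_tendsto:
  fixes f :: "'a::euclidean_space \<Rightarrow> real"
  assumes f: "integrable lborel f" and j: "j < n"
    and [measurable]: "\<And>k. k < n \<Longrightarrow> \<psi> k \<in> borel_measurable borel" "h \<in> borel_measurable borel" "K \<in> sets borel"
    and null_\<psi>: "\<And>k t. k < n \<Longrightarrow> AE p in lborel. \<psi> k p \<noteq> t"
    and null_h: "\<And>t. AE p in lborel. h p \<noteq> t"
    and s: "\<And>k. k < n \<Longrightarrow> (\<lambda>t. s t k) \<longlonglongrightarrow> s' k"
    and c: "\<And>k. k \<le> n \<Longrightarrow> (\<lambda>t. c t k) \<longlonglongrightarrow> c' k"
  shows "(\<lambda>t. LINT p:sliced_piece n \<psi> K h (s t) (c t) j|lborel. f p)
    \<longlonglongrightarrow> (LINT p:sliced_piece n \<psi> K h s' c' j|lborel. f p)"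
  unfolding set_lebesgue_integral_def
proof (rule integral_dominated_convergence[where w = "\<lambda>p. \<bar>f p\<bar>"])
  have meas: "sliced_piece n \<psi> K h s c j \<in> sets lborel" for s c
    using sliced_piece_measurable[of n \<psi> h K j] assms by simp
  then show "(\<lambda>p. indicat_real (sliced_piece n \<psi> K h s' c' j) p *\<^sub>R f p) \<in> borel_measurable lborel"
    "\<And>t. (\<lambda>p. indicat_real (sliced_piece n \<psi> K h (s t) (c t) j) p *\<^sub>R f p) \<in> borel_measurable lborel"
    using f by (auto intro!: borel_measurable_scaleR borel_measurable_indicator)
  show "integrable lborel (\<lambda>p. \<bar>f p\<bar>)"
    using f by simp
  show "AE p in lborel. norm (indicat_real (sliced_piece n \<psi> K h (s t) (c t) j) p *\<^sub>R f p) \<le> \<bar>f p\<bar>" for t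
    by (auto simp: indicator_def)
  have "AE p in lborel. \<forall>k\<in>{..<n}. \<psi> k p \<noteq> s' k"
    using null_\<psi> by (subst AE_finite_all) auto
  moreover have "AE p in lborel. h p \<noteq> c' j" "AE p in lborel. h p \<noteq> c' (Suc j)"
    by (rule null_h)+
  ultimately show "AE p in lborel. (\<lambda>t. indicat_real (sliced_piece n \<psi> K h (s t) (c t) j) p *\<^sub>R f p)
      \<longlonglongrightarrow> indicat_real (sliced_piece n \<psi> K h s' c' j) p *\<^sub>R f p"
  proof eventually_elim
    case (elim p)
    have "\<forall>\<^sub>F t in sequentially. \<forall>k\<in>{..<n}.
        (s t k < \<psi> k p \<longleftrightarrow> s' k < \<psi> k p) \<and> (s t k \<le> \<psi> k p \<longleftrightarrow> s' k \<le> \<psi> k p)"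
      using elim(1) s by (intro eventually_ball_finite ballI eventually_less_iff_limit) force+
    moreover have "\<forall>\<^sub>F t in sequentially. (c t j < h p \<longleftrightarrow> c' j < h p) \<and> (c t j \<le> h p \<longleftrightarrow> c' j \<le> h p)"
      using elim(2) j by (intro eventually_less_iff_limit c) auto
    moreover have "\<forall>\<^sub>F t in sequentially. (c t (Suc j) < h p \<longleftrightarrow> c' (Suc j) < h p) \<and>
        (c t (Suc j) \<le> h p \<longleftrightarrow> c' (Suc j) \<le> h p)"
      using elim(3) j by (intro eventually_less_iff_limit c) auto
    ultimately have "\<forall>\<^sub>F t in sequentially.
        p \<in> sliced_piece n \<psi> K h (s t) (c t) j \<longleftrightarrow> p \<in> sliced_piece n \<psi> K h s' c' j"
    proof eventually_elim
      case (elim t)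
      have "\<psi> j p \<le> s t j \<longleftrightarrow> \<psi> j p \<le> s' j"
        using elim(1) j by (metis lessThan_iff not_less)
      moreover have "(\<forall>k<n. s t k < \<psi> k p) \<longleftrightarrow> (\<forall>k<n. s' k < \<psi> k p)"
        using elim(1) by auto
      moreover have "h p < c t (Suc j) \<longleftrightarrow> h p < c' (Suc j)"
        using elim(3) by (metis not_less)
      ultimately show ?case
        using elim(2) by (simp add: sliced_piece_def)
    qed
    then have "\<forall>\<^sub>F t in sequentially. indicat_real (sliced_piece n \<psi> K h (s t) (c t) j) p *\<^sub>R f p
        = indicat_real (sliced_piece n \<psi> K h s' c' j) p *\<^sub>R f p"
      by eventually_elim (auto simp: indicator_def)
    then show ?case
      by (rule tendsto_eventually)
  qed
qed

text \<open>The whole division argument, with the geometry reduced to seeds and a height function.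
  The third conclusion is the dichotomy that later gives fatness: a lone seed of positive size, or a
  full seed together with part of \<open>K\<close>.\<close>

lemma envy_free_sliced_partition:
  fixes f :: "nat \<Rightarrow> 'a::euclidean_space \<Rightarrow> real" and \<psi> :: "nat \<Rightarrow> 'a \<Rightarrow> real"
    and h :: "'a \<Rightarrow> real" and \<rho> :: real
  assumes n: "0 < n"
    and f: "\<And>i. i < n \<Longrightarrow> integrable lborel (f i)" "\<And>i p. i < n \<Longrightarrow> 0 \<le> f i p"
    and meas: "\<And>k. k < n \<Longrightarrow> \<psi> k \<in> borel_measurable borel" "h \<in> borel_measurable borel" "K \<in> sets borel"
    and null_\<psi>: "\<And>k t. k < n \<Longrightarrow> AE p in lborel. \<psi> k p \<noteq> t"
    and null_h: "\<And>t. AE p in lborel. h p \<noteq> t"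
    and h: "\<And>p. p \<in> K \<Longrightarrow> 0 \<le> h p \<and> h p < 1"
    and \<psi>: "\<And>k p. k < n \<Longrightarrow> 0 \<le> \<psi> k p" and \<rho>: "0 < \<rho>"
    and disj: "\<And>j k p. j < n \<Longrightarrow> k < n \<Longrightarrow> \<psi> j p \<le> \<rho> \<Longrightarrow> \<psi> k p \<le> \<rho> \<Longrightarrow> j = k"
    and pos: "\<And>i. i < n \<Longrightarrow> 0 < (LINT p:K|lborel. f i p)"
  shows "\<exists>X. (\<forall>j<n. X j \<in> sets borel) \<and>
    (\<forall>i<n. \<forall>j<n. i \<noteq> j \<longrightarrow> X i \<inter> X j = {}) \<and>
    (\<forall>j<n. \<exists>k<n. (\<exists>r. 0 < r \<and> r \<le> \<rho> \<and> X j = {p. \<psi> k p \<le> r}) \<or>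
        {p. \<psi> k p \<le> \<rho>} \<subseteq> X j \<and> X j \<subseteq> {p. \<psi> k p \<le> \<rho>} \<union> K) \<and>
    (\<forall>i<n. \<forall>j<n. (LINT p:X j|lborel. f i p) \<le> (LINT p:X i|lborel. f i p)) \<and>
    (\<forall>i<n. (LINT p:K|lborel. f i p) / n \<le> (LINT p:X i|lborel. f i p))"
proof -
  \<comment> \<open>Up to 1/(2n) a coordinate feeds its seed, beyond that its layer. As the
    coordinates sum to 1, the excesses over 1/(2n) sum to at least 1/2, so the denominator of
    \<open>c\<close> never vanishes on the simplex; with the threshold 1/n it would vanish at the
    barycentre.\<close>
  define s where "s = (\<lambda>(x::nat \<Rightarrow> real) k::nat. \<rho> * min 1 (2 * n * x k))"
  define a where "a = (\<lambda>(x::nat \<Rightarrow> real) k::nat. max 0 (x k - 1 / (2 * n)))"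
  define c where "c = (\<lambda>x j. (\<Sum>k<j. a x k) / (\<Sum>k<n. a x k))"
  define P where "P = (\<lambda>x. sliced_piece n \<psi> K h (s x) (c x))"
  define u where "u = (\<lambda>i j x. LINT p:P x j|lborel. f i p)"
  have a0: "0 \<le> a x k" for x k
    by (simp add: a_def)
  have a_sum: "0 < (\<Sum>k<n. a x k)" if "x \<in> std_simplex n" for x
  proof -
    have "1 / 2 = (\<Sum>k<n. x k - 1 / (2 * n))"
      using that n by (simp add: sum_subtractf std_simplex_def)
    also have "\<dots> \<le> (\<Sum>k<n. a x k)"
      by (intro sum_mono) (simp add: a_def)
    finally show ?thesis
      by simp
  qed
  have s_le: "s x k \<le> \<rho>" for x k
    using \<rho> by (simp add: s_def mult_left_le)
  have c_mono: "c x j \<le> c x k" if "j \<le> k" for x j k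
    unfolding c_def using that
    by (intro divide_right_mono sum_mono2 sum_nonneg a0) auto
  have P_meas: "P x j \<in> sets borel" if "j < n" for x j
    unfolding P_def using meas that by (intro sliced_piece_measurable) auto
  have P_disj: "P x j \<inter> P x k = {}" if "j < n" "k < n" "j \<noteq> k" for x j k
  proof -
    have "c x (Suc j) \<le> c x k \<or> c x (Suc k) \<le> c x j"
      using that c_mono by (meson Suc_leI linorder_neqE_nat)
    then show ?thesis
      using that disj[OF that(1,2)] s_le[of x] unfolding P_def sliced_piece_def
      by (force dest: order_trans[OF _ s_le] simp: not_le[symmetric])
  qed
  have K_cover: "\<exists>j<n. p \<in> P x j" if p: "p \<in> K" and x: "x \<in> std_simplex n" for p x
  proof (cases "\<exists>k<n. \<psi> k p \<le> s x k")
    case True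
    then show ?thesis
      by (auto simp: P_def sliced_piece_def)
  next
    case False
    have cn: "c x n = 1"
      using a_sum[OF x] by (simp add: c_def)
    \<comment> \<open>Some upper cut lies above \<open>h p\<close> because \<open>c x n = 1\<close>.
      For the first such layer the lower cut is at most \<open>h p\<close>, by minimality or, at
      index 0, because \<open>c x 0 = 0\<close>.\<close>
    define j where "j = (LEAST j. h p < c x (Suc j))"
    obtain n' where n': "n = Suc n'"
      using n gr0_implies_Suc by blast
    have hn: "h p < c x (Suc n')"
      using h[OF p] cn n' by simp
    have j1: "h p < c x (Suc j)"
      unfolding j_def by (rule LeastI[of _ n']) (rule hn)
    have "j \<le> n'"
      unfolding j_def by (rule Least_le) (rule hn)
    moreover have "c x j \<le> h p"
    proof (cases j)
      case 0
      then show ?thesis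
        using h[OF p] by (simp add: c_def)
    next
      case (Suc i)
      then show ?thesis
        using not_less_Least[of i "\<lambda>j. h p < c x (Suc j)"] by (simp add: j_def)
    qed
    ultimately show ?thesis
      using False j1 p n' by (intro exI[of _ j]) (auto simp: P_def sliced_piece_def)
  qed
  have int_f: "integrable lborel (\<lambda>p. indicat_real A p * f i p)" if "i < n" "A \<in> sets borel" for i A
    using f(1)[OF that(1)] that(2) integrable_mult_indicator[of A lborel "f i"] by simp
  have u_sum: "(LINT p:K|lborel. f i p) \<le> (\<Sum>j<n. u i j x)" if i: "i < n" and x: "x \<in> std_simplex n" for i x
  proof -
    have "(LINT p:K|lborel. f i p) \<le> (LINT p|lborel. (\<Sum>j<n. indicat_real (P x j) p * f i p))"
      unfolding set_lebesgue_integral_def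
    proof (rule integral_mono)
      show "integrable lborel (\<lambda>p. indicat_real K p *\<^sub>R f i p)"
        using int_f[OF i meas(3)] by simp
      show "integrable lborel (\<lambda>p. \<Sum>j<n. indicat_real (P x j) p * f i p)"
        by (intro Bochner_Integration.integrable_sum int_f[OF i] P_meas) simp
      fix p
      show "indicat_real K p *\<^sub>R f i p \<le> (\<Sum>j<n. indicat_real (P x j) p * f i p)"
      proof (cases "p \<in> K")
        case True
        then obtain j where "j < n" "p \<in> P x j"
          using K_cover x by blast
        then show ?thesis
          using member_le_sum[of j "{..<n}" "\<lambda>j. indicat_real (P x j) p * f i p"] f(2)[OF i] True
          by simp
      next
        case False
        then show ?thesis
          using f(2)[OF i] by (auto intro!: sum_nonneg)
      qed
    qed
    also have "\<dots> = (\<Sum>j<n. u i j x)"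
      unfolding u_def set_lebesgue_integral_def real_scaleR_def
      by (intro Bochner_Integration.integral_sum int_f[OF i] P_meas) simp
    finally show ?thesis .
  qed
  have u_ex: "\<exists>j<n. (LINT p:K|lborel. f i p) / n \<le> u i j x" if i: "i < n" and x: "x \<in> std_simplex n" for i x
  proof (rule ccontr)
    assume "\<not> ?thesis"
    then have "(\<Sum>j<n. u i j x) < (\<Sum>j<n. (LINT p:K|lborel. f i p) / n)"
      using n by (intro sum_strict_mono) auto
    then show False
      using u_sum[OF i x] n by simp
  qed
  have face: "u i j x = 0" if x: "x \<in> std_simplex n" and ij: "i < n" "j < n" and xj: "x j = 0" for i j x
  proof -
    have "c x (Suc j) = c x j"
      using xj by (simp add: c_def a_def)
    then have "P x j = {p. \<psi> j p \<le> 0}"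
      using xj by (auto simp: P_def sliced_piece_def s_def)
    \<comment> \<open>As \<open>\<psi> j\<close> is nonnegative, this sublevel set is the level set
      at 0, which is null.\<close>
    then have "AE p in lborel. p \<notin> P x j"
      using null_\<psi>[OF ij(2), of 0] \<psi>[OF ij(2)] by (auto elim!: eventually_mono simp: order.antisym)
    then have "AE p in lborel. indicat_real (P x j) p *\<^sub>R f i p = 0"
      by eventually_elim simp
    then show ?thesis
      unfolding u_def set_lebesgue_integral_def by (rule integral_eq_zero_AE)
  qed
  have cont: "continuous_on (std_simplex n) (u i j)" if ij: "i < n" "j < n" for i j
    unfolding continuous_on_sequentially o_def u_def P_def
  proof (intro allI ballI impI, elim conjE)
    fix X x assume x: "x \<in> std_simplex n" and "\<forall>t. X t \<in> std_simplex n" and "X \<longlonglongrightarrow> x"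
    then have lim: "(\<lambda>t. X t k) \<longlonglongrightarrow> x k" for k
      by (simp add: tendsto_fun_componentwise)
    show "(\<lambda>t. LINT p:sliced_piece n \<psi> K h (s (X t)) (c (X t)) j|lborel. f i p)
      \<longlonglongrightarrow> (LINT p:sliced_piece n \<psi> K h (s x) (c x) j|lborel. f i p)"
    proof (rule sliced_piece_integral_tendsto)
      show "(\<lambda>t. s (X t) k) \<longlonglongrightarrow> s x k" for k
        unfolding s_def by (intro tendsto_intros lim)
      show "(\<lambda>t. c (X t) k) \<longlonglongrightarrow> c x k" for k
        unfolding c_def a_def using a_sum[OF x]
        by (intro tendsto_intros lim) (simp add: a_def)
    qed (use f meas null_\<psi> null_h ij in auto)
  qed
  \<comment> \<open>The smallest 1/n share of \<open>K\<close> over all agents serves as the common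
    constant in \<open>rainbow_covering\<close>.\<close>
  define e where "e = Min ((\<lambda>i. (LINT p:K|lborel. f i p) / n) ` {..<n})"
  have e0: "0 < e"
    unfolding e_def using n pos by (subst Min_gr_iff) auto
  have e_le: "e \<le> (LINT p:K|lborel. f i p) / n" if "i < n" for i
    unfolding e_def using that by (intro Min_le) auto
  have "\<exists>x\<in>std_simplex n. \<exists>\<pi>. \<pi> permutes {..<n} \<and> (\<forall>i<n. \<forall>k<n. u i k x \<le> u i (\<pi> i) x)"
  proof (rule rainbow_covering[OF n e0 cont face])
    fix x i assume "x \<in> std_simplex n" "i < n"
    then show "\<exists>j<n. e \<le> u i j x"
      using u_ex[of i x] e_le[of i] order_trans by blast
  qed
  then obtain x \<pi> where x: "x \<in> std_simplex n" and \<pi>: "\<pi> permutes {..<n}"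
    and best: "\<And>i k. i < n \<Longrightarrow> k < n \<Longrightarrow> u i k x \<le> u i (\<pi> i) x"
    by blast
  have \<pi>n: "\<pi> j < n" if "j < n" for j
    using permutes_in_image[OF \<pi>, of j] that by simp
  have share: "(LINT p:K|lborel. f i p) / n \<le> u i (\<pi> i) x" if "i < n" for i
    using u_ex[OF that x] best[OF that] order_trans by blast
  have shape: "(\<exists>r. 0 < r \<and> r \<le> \<rho> \<and> P x k = {p. \<psi> k p \<le> r}) \<or>
        {p. \<psi> k p \<le> \<rho>} \<subseteq> P x k \<and> P x k \<subseteq> {p. \<psi> k p \<le> \<rho>} \<union> K" if xk: "0 < x k" and k: "k < n" for k
  proof (cases "2 * n * x k \<le> 1")
    case True
    then have "a x k = 0"
      using n by (simp add: a_def field_simps)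
    then have "c x (Suc k) = c x k"
      by (simp add: c_def)
    then have "P x k = {p. \<psi> k p \<le> s x k}"
      by (auto simp: P_def sliced_piece_def)
    moreover have "0 < s x k"
      using xk n \<rho> by (simp add: s_def)
    ultimately show ?thesis
      using s_le by blast
  next
    case False
    then have "s x k = \<rho>"
      by (simp add: s_def)
    then show ?thesis
      by (auto simp: P_def sliced_piece_def)
  qed
  \<comment> \<open>A favourite piece has positive value, so \<open>face\<close> rules out the
    coordinate 0. This excludes the degenerate seed of size 0.\<close>
  have x\<pi>: "0 < x (\<pi> i)" if i: "i < n" for i
  proof -
    have "0 < u i (\<pi> i) x"
      using share[OF i] pos[OF i] n by (smt (verit) divide_pos_pos of_nat_0_less_iff)
    then have "x (\<pi> i) \<noteq> 0"
      using face[OF x i \<pi>n[OF i]] by auto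
    then show ?thesis
      using x \<pi>n[OF i] by (auto simp: std_simplex_def less_le)
  qed
  show ?thesis
  proof (intro exI[of _ "\<lambda>i. P x (\<pi> i)"] conjI allI impI)
    fix i assume i: "i < n"
    show "P x (\<pi> i) \<in> sets borel"
      using P_meas \<pi>n i by blast
    show "\<exists>k<n. (\<exists>r. 0 < r \<and> r \<le> \<rho> \<and> P x (\<pi> i) = {p. \<psi> k p \<le> r}) \<or>
        {p. \<psi> k p \<le> \<rho>} \<subseteq> P x (\<pi> i) \<and> P x (\<pi> i) \<subseteq> {p. \<psi> k p \<le> \<rho>} \<union> K"
      using shape[OF x\<pi>[OF i] \<pi>n[OF i]] \<pi>n[OF i] by blast
    show "(LINT p:K|lborel. f i p) / n \<le> (LINT p:P x (\<pi> i)|lborel. f i p)"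
      using share[OF i] by (simp add: u_def)
    fix j assume j: "j < n"
    show "(LINT p:P x (\<pi> j)|lborel. f i p) \<le> (LINT p:P x (\<pi> i)|lborel. f i p)"
      using best[OF i \<pi>n[OF j]] by (simp add: u_def)
    show "P x (\<pi> i) \<inter> P x (\<pi> j) = {}" if "i \<noteq> j"
      using that P_disj[OF \<pi>n[OF i] \<pi>n[OF j]] inj_eq[OF permutes_inj[OF \<pi>]] by blast
  qed
qed

section \<open>Cubes and fatness\<close>

text \<open>For an orthonormal frame \<open>w\<close>, a cube recorded by the coordinates of its
  centre and half its side. Inclusion and disjointness of parallel cubes become inequalities between
  numbers.\<close>

definition oriented_box :: "('d::finite \<Rightarrow> real^'d) \<Rightarrow> ('d \<Rightarrow> real) \<Rightarrow> real \<Rightarrow> (real^'d) set" where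
  "oriented_box w \<gamma> r = {p. \<forall>i. \<bar>w i \<bullet> p - \<gamma> i\<bar> \<le> r}"

lemma cube_eq_oriented_box:
  fixes Q :: "real^'d \<Rightarrow> real^'d"
  assumes Q: "orthogonal_transformation Q"
  shows "cube Q c l = oriented_box (\<lambda>i. Q (axis i 1)) (\<lambda>i. Q (axis i 1) \<bullet> c + l / 2) (l / 2)"
proof -
  have coord: "Q (axis i 1) \<bullet> Q x = x $ i" for i x
    using Q by (simp add: orthogonal_transformation_def inner_axis')
  show ?thesis
  proof (intro set_eqI iffI)
    fix p assume "p \<in> cube Q c l"
    then obtain x where p: "p = c + Q x" and x: "\<And>i. 0 \<le> x $ i \<and> x $ i \<le> l"
      by (auto simp: cube_def)
    have "\<bar>x $ i - l / 2\<bar> \<le> l / 2" for i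
      using x[of i] by (simp add: abs_le_iff field_simps)
    then show "p \<in> oriented_box (\<lambda>i. Q (axis i 1)) (\<lambda>i. Q (axis i 1) \<bullet> c + l / 2) (l / 2)"
      by (simp add: p oriented_box_def inner_add_right coord)
  next
    fix p assume p: "p \<in> oriented_box (\<lambda>i. Q (axis i 1)) (\<lambda>i. Q (axis i 1) \<bullet> c + l / 2) (l / 2)"
    obtain x where x: "Q x = p - c"
      using orthogonal_transformation_surj[OF Q] by (metis surjD)
    have "0 \<le> x $ i \<and> x $ i \<le> l" for i
    proof -
      have "\<bar>Q (axis i 1) \<bullet> p - (Q (axis i 1) \<bullet> c + l / 2)\<bar> \<le> l / 2"
        using p by (auto simp: oriented_box_def)
      moreover have "x $ i = Q (axis i 1) \<bullet> p - Q (axis i 1) \<bullet> c"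
        using coord[of i x] by (simp add: x inner_diff_right)
      ultimately show ?thesis
        by (simp add: abs_le_iff field_simps)
    qed
    moreover have "p = c + Q x"
      by (simp add: x)
    ultimately show "p \<in> cube Q c l"
      by (auto simp: cube_def)
  qed
qed

lemma oriented_box_eq_cube:
  fixes Q :: "real^'d \<Rightarrow> real^'d"
  assumes Q: "orthogonal_transformation Q"
  shows "oriented_box (\<lambda>i. Q (axis i 1)) \<gamma> r = cube Q (Q (\<chi> i. \<gamma> i - r)) (2 * r)"
proof -
  have "Q (axis i 1) \<bullet> Q x = x $ i" for i x
    using Q by (simp add: orthogonal_transformation_def inner_axis')
  then show ?thesis
    by (simp add: cube_eq_oriented_box[OF Q])
qed

lemma fat_oriented_boxI:
  fixes Q :: "real^'d \<Rightarrow> real^'d"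
  assumes Q: "orthogonal_transformation Q" and "0 < r"
    and "oriented_box (\<lambda>i. Q (axis i 1)) \<gamma> r \<subseteq> X" "X \<subseteq> oriented_box (\<lambda>i. Q (axis i 1)) \<eta> s" "s / r \<le> R"
  shows "fat R X"
  unfolding fat_def
  using assms unfolding oriented_box_eq_cube[OF Q]
  by (intro exI[of _ Q] exI[of _ "Q (\<chi> i. \<gamma> i - r)"] exI[of _ "Q (\<chi> i. \<eta> i - s)"]
      exI[of _ "2 * r"] exI[of _ "2 * s"]) auto

lemma closed_oriented_box: "closed (oriented_box w \<gamma> r)"
proof -
  have "oriented_box w \<gamma> r = (\<Inter>i. {p. \<bar>w i \<bullet> p - \<gamma> i\<bar> \<le> r})"
    by (auto simp: oriented_box_def)
  also have "closed \<dots>"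
    by (intro closed_INT ballI closed_Collect_le continuous_intros)
  finally show ?thesis .
qed

lemma AE_inner_neq:
  fixes w :: "'a::euclidean_space"
  assumes "w \<noteq> 0"
  shows "AE p in lborel. w \<bullet> p \<noteq> t"
proof -
  have "negligible {p. w \<bullet> p = t}"
    using assms by (intro negligible_hyperplane) auto
  moreover have "{p. w \<bullet> p = t} \<in> sets borel"
    by (intro borel_closed closed_hyperplane)
  ultimately have "{p. w \<bullet> p = t} \<in> null_sets lborel"
    by (simp add: negligible_iff_null_sets null_sets_completion_iff)
  then show ?thesis
    by (rule AE_I'[of _ lborel]) auto
qed

text \<open>Supplies the functions \<open>\<psi>\<close>: the sublevel sets are concentric boxes, so
  growing a seed means raising a level.\<close>

definition box_gauge :: "('d::finite \<Rightarrow> real^'d) \<Rightarrow> ('d \<Rightarrow> real) \<Rightarrow> real^'d \<Rightarrow> real" where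
  "box_gauge w \<gamma> p = Max (range (\<lambda>i. \<bar>w i \<bullet> p - \<gamma> i\<bar>))"

lemma box_gauge_le_iff: "box_gauge w \<gamma> p \<le> r \<longleftrightarrow> p \<in> oriented_box w \<gamma> r"
  by (simp add: box_gauge_def oriented_box_def)

lemma box_gauge_nonneg: "0 \<le> box_gauge w \<gamma> p"
  unfolding box_gauge_def by (simp add: Max_ge_iff)

lemma borel_measurable_box_gauge: "box_gauge w \<gamma> \<in> borel_measurable borel"
  using closed_oriented_box
  by (auto simp: borel_measurable_iff_le box_gauge_le_iff intro: borel_closed)

text \<open>A level set lies in the finitely many hyperplanes that carry the faces of a box.\<close>

lemma AE_box_gauge_neq:
  assumes "\<And>i. w i \<noteq> 0"
  shows "AE p in lborel. box_gauge w \<gamma> p \<noteq> t"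
proof -
  have "AE p in lborel. \<forall>i\<in>UNIV. w i \<bullet> p \<noteq> \<gamma> i + t \<and> w i \<bullet> p \<noteq> \<gamma> i - t"
    using AE_inner_neq[OF assms] by (subst AE_finite_all) auto
  then show ?thesis
  proof eventually_elim
    case (elim p)
    have "box_gauge w \<gamma> p \<in> range (\<lambda>i. \<bar>w i \<bullet> p - \<gamma> i\<bar>)"
      unfolding box_gauge_def by (intro Max_in) auto
    then obtain i where i: "box_gauge w \<gamma> p = \<bar>w i \<bullet> p - \<gamma> i\<bar>"
      by blast
    have "w i \<bullet> p \<noteq> \<gamma> i + t \<and> w i \<bullet> p \<noteq> \<gamma> i - t"
      using elim by blast
    with i show ?case
      by linarith
  qed
qed

section \<open>Grid cells and inclusions of parallel boxes\<close>

lemma grid_injection: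
  assumes "n \<le> m ^ CARD('d::finite)"
  shows "\<exists>g :: nat \<Rightarrow> 'd \<Rightarrow> nat. inj_on g {..<n} \<and> (\<forall>j i. j < n \<longrightarrow> g j i < m)"
proof -
  have "card (PiE (UNIV::'d set) (\<lambda>_. {..<m})) = m ^ CARD('d)"
    by (simp add: card_PiE)
  moreover have "finite (PiE (UNIV::'d set) (\<lambda>_. {..<m}))"
    by (intro finite_PiE) auto
  ultimately obtain g where g: "inj_on g {..<n}" "g ` {..<n} \<subseteq> PiE (UNIV::'d set) (\<lambda>_. {..<m})"
    using assms card_le_inj[of "{..<n}" "PiE (UNIV::'d set) (\<lambda>_. {..<m})"] by auto
  moreover have "\<forall>j i. j < n \<longrightarrow> g j i < m"
    using g(2) by (auto simp: subset_iff PiE_iff)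
  ultimately show ?thesis
    by blast
qed

lemma le_root_ceiling_power:
  assumes "0 < n" "0 < d"
  shows "n \<le> nat \<lceil>real n powr (1 / real d)\<rceil> ^ d"
proof -
  define m where "m = nat \<lceil>real n powr (1 / real d)\<rceil>"
  have "real n = (real n powr (1 / real d)) ^ d"
    using assms by (simp add: powr_powr flip: powr_realpow)
  also have "\<dots> \<le> real m ^ d"
    unfolding m_def by (intro power_mono) (auto simp: real_nat_ceiling_ge)
  finally show ?thesis
    unfolding m_def by (metis of_nat_le_iff of_nat_power)
qed

text \<open>Tested at two opposite corners. It turns the inclusion of a cell in the outer cube into
  a bound on the distance of their centres, a form that scales under homotheties.\<close>

lemma oriented_box_subset_imp:
  fixes Q :: "real^'d \<Rightarrow> real^'d"
  assumes Q: "orthogonal_transformation Q" and r: "0 \<le> r"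
    and sub: "oriented_box (\<lambda>i. Q (axis i 1)) \<gamma> r \<subseteq> oriented_box (\<lambda>i. Q (axis i 1)) \<eta> s"
  shows "\<bar>\<gamma> i - \<eta> i\<bar> + r \<le> s"
proof -
  have coord: "Q (axis i 1) \<bullet> Q x = x $ i" for i x
    using Q by (simp add: orthogonal_transformation_def inner_axis')
  have "Q (\<chi> i. \<gamma> i + r) \<in> oriented_box (\<lambda>i. Q (axis i 1)) \<gamma> r"
    "Q (\<chi> i. \<gamma> i - r) \<in> oriented_box (\<lambda>i. Q (axis i 1)) \<gamma> r"
    using r by (simp_all add: oriented_box_def coord)
  with sub have "Q (\<chi> i. \<gamma> i + r) \<in> oriented_box (\<lambda>i. Q (axis i 1)) \<eta> s"
    "Q (\<chi> i. \<gamma> i - r) \<in> oriented_box (\<lambda>i. Q (axis i 1)) \<eta> s"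
    by blast+
  then have "\<bar>\<gamma> i + r - \<eta> i\<bar> \<le> s" "\<bar>\<gamma> i - r - \<eta> i\<bar> \<le> s"
    by (simp_all add: oriented_box_def coord)
  then show ?thesis
    by linarith
qed

lemma oriented_box_mono:
  assumes "\<And>i. \<bar>\<gamma> i - \<eta> i\<bar> + r \<le> s"
  shows "oriented_box w \<gamma> r \<subseteq> oriented_box w \<eta> s"
proof
  fix p assume p: "p \<in> oriented_box w \<gamma> r"
  have "\<bar>w i \<bullet> p - \<eta> i\<bar> \<le> s" for i
  proof -
    have "\<bar>w i \<bullet> p - \<gamma> i\<bar> \<le> r"
      using p by (auto simp: oriented_box_def)
    then show ?thesis
      using assms[of i] by linarith
  qed
  then show "p \<in> oriented_box w \<eta> s"
    by (auto simp: oriented_box_def)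
qed

text \<open>A value density is constrained on \<open>C\<close> only; its extension by 0 is
  nonnegative and integrable on the whole space, as \<open>envy_free_sliced_partition\<close>
  requires.\<close>

lemma value_measure_extend:
  assumes v: "value_measure C v"
  shows "integrable lborel (\<lambda>p. indicat_real C p * v p)" "0 \<le> indicat_real C p * v p"
    "X \<subseteq> C \<Longrightarrow> val v X = (LINT p:X|lborel. indicat_real C p * v p)"
proof -
  show "integrable lborel (\<lambda>p. indicat_real C p * v p)"
    using v by (simp add: value_measure_def set_integrable_def)
  show "0 \<le> indicat_real C p * v p"
    using v by (simp add: value_measure_def indicator_def)
  show "X \<subseteq> C \<Longrightarrow> val v X = (LINT p:X|lborel. indicat_real C p * v p)"
    unfolding val_def set_lebesgue_integral_def
    by (intro Bochner_Integration.integral_cong) (auto simp: indicator_def)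
qed

lemma val_mono:
  assumes v: "value_measure C v" and "X \<subseteq> Y" "Y \<subseteq> C" "X \<in> sets borel" "Y \<in> sets borel"
  shows "val v X \<le> val v Y"
proof -
  have "(LINT p:X|lborel. indicat_real C p * v p) \<le> (LINT p:Y|lborel. indicat_real C p * v p)"
    unfolding set_lebesgue_integral_def
  proof (rule integral_mono)
    show "integrable lborel (\<lambda>p. indicat_real X p *\<^sub>R (indicat_real C p * v p))"
      "integrable lborel (\<lambda>p. indicat_real Y p *\<^sub>R (indicat_real C p * v p))"
      by (intro integrable_mult_indicator value_measure_extend(1)[OF v]; use assms in simp)+
    show "indicat_real X p *\<^sub>R (indicat_real C p * v p) \<le> indicat_real Y p *\<^sub>R (indicat_real C p * v p)" for p
      using value_measure_extend(2)[OF v, of p] \<open>X \<subseteq> Y\<close> by (auto simp: indicator_def)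
  qed
  then show ?thesis
    using assms value_measure_extend(3)[OF v] by auto
qed

lemma valS_eq_val:
  assumes v: "value_measure C v" and S: "S \<subseteq> sets borel" "X \<in> S" "X \<subseteq> C"
  shows "valS S v X = val v X"
  unfolding valS_def
proof (rule cSup_eq_maximum)
  show "val v X \<in> {val v s |s. s \<in> S \<and> s \<subseteq> X}"
    using S by blast
  show "y \<le> val v X" if "y \<in> {val v s |s. s \<in> S \<and> s \<subseteq> X}" for y
    using that S by (auto intro!: val_mono[OF v])
qed

text \<open>The boxes are images of the outer box under homotheties of ratio
  \<open>1 - \<epsilon> t\<close> centred at the points with coordinates \<open>\<gamma> j\<close>.
  Every interior point of the outer box eventually lies in all of them, and its boundary is
  null.\<close>

lemma shrunk_box_integral_tendsto:
  fixes f :: "real^'d \<Rightarrow> real" and n :: nat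
  assumes f: "integrable lborel f" and C: "C \<in> sets borel" "C \<subseteq> oriented_box w \<eta> s"
    and w: "\<And>i. w i \<noteq> 0" and \<epsilon>: "\<epsilon> \<longlonglongrightarrow> 0"
  shows "(\<lambda>t. LINT p:C \<inter> (\<Inter>j<n. oriented_box w (\<lambda>i. \<gamma> j i + (1 - \<epsilon> t) * (\<eta> i - \<gamma> j i)) ((1 - \<epsilon> t) * s))|lborel. f p)
    \<longlonglongrightarrow> (LINT p:C|lborel. f p)"
proof -
  define K where "K = (\<lambda>t. C \<inter> (\<Inter>j<n. oriented_box w (\<lambda>i. \<gamma> j i + (1 - \<epsilon> t) * (\<eta> i - \<gamma> j i)) ((1 - \<epsilon> t) * s)))"
  have K: "K t \<in> sets borel" for t
    unfolding K_def by (intro sets.Int C(1)) (intro borel_closed closed_INT ballI closed_oriented_box)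
  have "(\<lambda>t. LINT p:K t|lborel. f p) \<longlonglongrightarrow> (LINT p:C|lborel. f p)"
    unfolding set_lebesgue_integral_def
  proof (rule integral_dominated_convergence[where w = "\<lambda>p. \<bar>f p\<bar>"])
    show "(\<lambda>p. indicat_real C p *\<^sub>R f p) \<in> borel_measurable lborel"
      "\<And>t. (\<lambda>p. indicat_real (K t) p *\<^sub>R f p) \<in> borel_measurable lborel"
      using f C(1) K by (auto intro!: borel_measurable_scaleR borel_measurable_indicator)
    show "integrable lborel (\<lambda>p. \<bar>f p\<bar>)"
      using f by simp
    show "AE p in lborel. norm (indicat_real (K t) p *\<^sub>R f p) \<le> \<bar>f p\<bar>" for t
      by (auto simp: indicator_def)
    have "AE p in lborel. box_gauge w \<eta> p \<noteq> s"
      by (rule AE_box_gauge_neq[OF w])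
    then show "AE p in lborel. (\<lambda>t. indicat_real (K t) p *\<^sub>R f p) \<longlonglongrightarrow> indicat_real C p *\<^sub>R f p"
    proof eventually_elim
      case (elim p)
      have "\<forall>\<^sub>F t in sequentially. p \<in> K t \<longleftrightarrow> p \<in> C"
      proof (cases "p \<in> C")
        case True
        then have "box_gauge w \<eta> p < s"
          using C(2) elim by (auto simp: less_le box_gauge_le_iff)
        then have lt: "\<bar>w i \<bullet> p - \<eta> i\<bar> < s" for i
          by (simp add: box_gauge_def)
        have "\<forall>\<^sub>F t in sequentially. \<forall>j\<in>{..<n}. \<forall>i\<in>UNIV.
            \<bar>w i \<bullet> p - (\<gamma> j i + (1 - \<epsilon> t) * (\<eta> i - \<gamma> j i))\<bar> - (1 - \<epsilon> t) * s < 0"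
        proof (intro eventually_ball_finite ballI)
          fix j i
          have "(\<lambda>t. \<bar>w i \<bullet> p - (\<gamma> j i + (1 - \<epsilon> t) * (\<eta> i - \<gamma> j i))\<bar> - (1 - \<epsilon> t) * s)
              \<longlonglongrightarrow> \<bar>w i \<bullet> p - (\<gamma> j i + (1 - 0) * (\<eta> i - \<gamma> j i))\<bar> - (1 - 0) * s"
            by (intro tendsto_intros \<epsilon>)
          then show "\<forall>\<^sub>F t in sequentially.
              \<bar>w i \<bullet> p - (\<gamma> j i + (1 - \<epsilon> t) * (\<eta> i - \<gamma> j i))\<bar> - (1 - \<epsilon> t) * s < 0"
            by (rule order_tendstoD(2)) (use lt[of i] in simp)
        qed auto
        then show ?thesis
          by eventually_elim (use True in \<open>auto simp: K_def oriented_box_def less_imp_le\<close>)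
      qed (simp add: K_def)
      then have "\<forall>\<^sub>F t in sequentially. indicat_real (K t) p *\<^sub>R f p = indicat_real C p *\<^sub>R f p"
        by eventually_elim (auto simp: indicator_def)
      then show ?case
        by (rule tendsto_eventually)
    qed
  qed
  then show ?thesis
    by (simp only: K_def)
qed

section \<open>Envy-free allocations of fat pieces\<close>

text \<open>The factor \<open>c\<close> pays for replacing \<open>C\<close> by
  \<open>K \<epsilon>\<close>, its part inside all contracted outer cubes at once. The intersection
  is taken because a layer may be attached to the seed of any cell and must fit the contracted cube
  of that cell.\<close>

lemma near_proportional_envy_free_allocation:
  fixes C :: "(real^'d) set"
  assumes n: "0 < n" "n \<le> m ^ CARD('d)" and R: "1 \<le> R"
    and C: "C \<in> sets borel" "fat R C"
    and v: "\<And>i. i < n \<Longrightarrow> value_measure C (v i)"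
    and c: "0 < c" "c < 1"
  defines "S \<equiv> {X. X \<in> sets borel \<and> fat (real m * R) X}"
  shows "\<exists>X. S_allocation C n S X \<and> envy_free n S v X \<and> (\<forall>i<n. c * val (v i) C / n \<le> val (v i) (X i))"
proof -
  obtain Q a b l1 l2 where Q: "orthogonal_transformation Q" and l1: "0 < l1"
    and sub1: "cube Q a l1 \<subseteq> C" and sub2: "C \<subseteq> cube Q b l2" and ratio: "l2 / l1 \<le> R"
    using C(2) unfolding fat_def by blast
  obtain g :: "nat \<Rightarrow> 'd \<Rightarrow> nat" where g_inj: "inj_on g {..<n}" and g: "\<And>j i. j < n \<Longrightarrow> g j i < m"
    using grid_injection[OF n(2)] by blast
  have m: "0 < m"
    using g[of 0] n by force
  define w where "w = (\<lambda>i. Q (axis i 1))"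
  define \<alpha> where "\<alpha> = (\<lambda>i. w i \<bullet> a + l1 / 2)"
  define \<eta> where "\<eta> = (\<lambda>i. w i \<bullet> b + l2 / 2)"
  \<comment> \<open>Half the side of a cell when the inner cube is cut into \<open>m\<close> parts
    in each direction; \<open>\<gamma> j\<close> is the centre of the cell with index
    \<open>g j\<close>.\<close>
  define q where "q = l1 / (2 * m)"
  define \<gamma> where "\<gamma> = (\<lambda>j i. w i \<bullet> a + (2 * real (g j i) + 1) * q)"
  have q: "0 < q" and l1q: "l1 = 2 * m * q"
    using l1 m by (simp_all add: q_def)
  have w0: "w i \<noteq> 0" for i
    using orthogonal_transformation_norm[OF Q, of "axis i 1"] by (auto simp: w_def)
  have B1: "oriented_box w \<alpha> (l1 / 2) \<subseteq> C"
    using sub1 unfolding cube_eq_oriented_box[OF Q] w_def \<alpha>_def .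
  have B2: "C \<subseteq> oriented_box w \<eta> (l2 / 2)"
    using sub2 unfolding cube_eq_oriented_box[OF Q] w_def \<eta>_def .
  have cell: "oriented_box w (\<gamma> j) q \<subseteq> oriented_box w \<alpha> (l1 / 2)" if j: "j < n" for j
  proof (rule oriented_box_mono)
    fix i
    have "\<gamma> j i - \<alpha> i = (2 * real (g j i) + 1 - m) * q"
      by (simp add: \<gamma>_def \<alpha>_def l1q algebra_simps)
    moreover have "\<bar>2 * real (g j i) + 1 - m\<bar> \<le> real m - 1"
      using g[OF j, of i] by linarith
    ultimately have "\<bar>\<gamma> j i - \<alpha> i\<bar> \<le> (real m - 1) * q"
      using q by (simp add: abs_mult mult_right_mono)
    then show "\<bar>\<gamma> j i - \<alpha> i\<bar> + q \<le> l1 / 2"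
      by (simp add: l1q algebra_simps)
  qed
  have cell_dist: "\<bar>\<gamma> j i - \<eta> i\<bar> + q \<le> l2 / 2" if j: "j < n" for i j
    using oriented_box_subset_imp[OF Q, of q "\<gamma> j" \<eta> "l2 / 2"] cell[OF j] B1 B2 q
    by (simp add: w_def)
  have l2: "0 < l2"
    using cell_dist[OF n(1), of undefined] abs_ge_zero[of "\<gamma> 0 undefined - \<eta> undefined"] q by linarith
  define f where "f = (\<lambda>i p. indicat_real C p * v i p)"
  have f: "integrable lborel (f i)" "0 \<le> f i p" "X \<subseteq> C \<Longrightarrow> val (v i) X = (LINT p:X|lborel. f i p)"
    if "i < n" for i p X
    using value_measure_extend[OF v[OF that]] by (simp_all add: f_def)
  have val_pos: "0 < val (v i) C" if "i < n" for i
    using v[OF that] by (simp add: value_measure_def)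
  define K where "K = (\<lambda>\<epsilon>. C \<inter> (\<Inter>j<n. oriented_box w (\<lambda>i. \<gamma> j i + (1 - \<epsilon>) * (\<eta> i - \<gamma> j i)) ((1 - \<epsilon>) * (l2 / 2))))"
  have lim: "(\<lambda>t. LINT p:K (1 / real (Suc (Suc t)))|lborel. f i p) \<longlonglongrightarrow> val (v i) C" if i: "i < n" for i
    unfolding K_def f(3)[OF i subset_refl]
    by (rule shrunk_box_integral_tendsto[OF f(1)[OF i] C(1) B2 w0])
      (use LIMSEQ_Suc[OF LIMSEQ_Suc[OF lim_1_over_n[where 'a = real]]] in simp)
  have "\<forall>\<^sub>F t in sequentially. \<forall>i\<in>{..<n}. c * val (v i) C < (LINT p:K (1 / real (Suc (Suc t)))|lborel. f i p)"
  proof (intro eventually_ball_finite ballI)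
    fix i assume "i \<in> {..<n}"
    then have i: "i < n" by simp
    have "c * val (v i) C < val (v i) C"
      using c val_pos[OF i] by simp
    then show "\<forall>\<^sub>F t in sequentially. c * val (v i) C < (LINT p:K (1 / real (Suc (Suc t)))|lborel. f i p)"
      by (rule order_tendstoD(1)[OF lim[OF i]])
  qed simp
  then obtain t where t: "\<forall>i\<in>{..<n}. c * val (v i) C < (LINT p:K (1 / real (Suc (Suc t)))|lborel. f i p)"
    using eventually_happens'[OF sequentially_bot] by blast
  \<comment> \<open>The double successor keeps \<open>\<epsilon>\<close> below 1 even for
    \<open>t = 0\<close>, so that the contracted cells do not collapse.\<close>
  define \<epsilon> where "\<epsilon> = 1 / real (Suc (Suc t))"
  have \<epsilon>: "0 < \<epsilon>" "\<epsilon> < 1"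
    by (simp_all add: \<epsilon>_def)
  have big: "c * val (v i) C < (LINT p:K \<epsilon>|lborel. f i p)" if "i < n" for i
    using t that by (simp add: \<epsilon>_def)
  txt \<open>Closed cubes with side exactly \<open>l1 / m\<close> cannot be made disjoint in general (e.g. if \<open>n = m ^ d\<close>).  So each
    cell is shrunk about its own centre, and the homothety shrinking cell \<open>j\<close> also takes the outer cube to \<open>B j\<close>,
    which preserves the ratio of the two sides.\<close>
  define B where "B = (\<lambda>j. oriented_box w (\<lambda>i. \<gamma> j i + (1 - \<epsilon>) * (\<eta> i - \<gamma> j i)) ((1 - \<epsilon>) * (l2 / 2)))"
  have K: "K \<epsilon> = C \<inter> (\<Inter>j<n. B j)"
    by (simp add: K_def B_def)
  define \<rho> where "\<rho> = (1 - \<epsilon>) * q"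
  have \<rho>: "0 < \<rho>" "\<rho> < q"
    using \<epsilon> q by (simp_all add: \<rho>_def)
  define \<psi> where "\<psi> = (\<lambda>j. box_gauge w (\<gamma> j))"
  have \<psi>: "{p. \<psi> j p \<le> r} = oriented_box w (\<gamma> j) r" for j r
    by (simp add: \<psi>_def box_gauge_le_iff)
  have seed_C: "oriented_box w (\<gamma> j) r \<subseteq> C" if "j < n" "r \<le> \<rho>" for j r
  proof -
    have "oriented_box w (\<gamma> j) r \<subseteq> oriented_box w (\<gamma> j) q"
      using that \<rho> by (intro oriented_box_mono) simp
    then show ?thesis
      using cell[OF that(1)] B1 by blast
  qed
  have seed_B: "oriented_box w (\<gamma> j) \<rho> \<subseteq> B j" if j: "j < n" for j
    unfolding B_def
  proof (rule oriented_box_mono)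
    fix i
    have "\<bar>\<gamma> j i - (\<gamma> j i + (1 - \<epsilon>) * (\<eta> i - \<gamma> j i))\<bar> + \<rho> = (1 - \<epsilon>) * (\<bar>\<gamma> j i - \<eta> i\<bar> + q)"
      using \<epsilon> by (simp add: \<rho>_def abs_mult abs_minus_commute distrib_left)
    also have "\<dots> \<le> (1 - \<epsilon>) * (l2 / 2)"
      using \<epsilon> cell_dist[OF j] by (intro mult_left_mono) auto
    finally show "\<bar>\<gamma> j i - (\<gamma> j i + (1 - \<epsilon>) * (\<eta> i - \<gamma> j i))\<bar> + \<rho> \<le> (1 - \<epsilon>) * (l2 / 2)" .
  qed
  \<comment> \<open>Distinct cells have centres at least \<open>2 * q\<close> apart in some frame
    direction, while the seeds have half-side at most \<open>\<rho> < q\<close>.\<close>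
  have disj: "j = k" if jk: "j < n" "k < n" and p: "\<psi> j p \<le> \<rho>" "\<psi> k p \<le> \<rho>" for j k p
  proof (rule ccontr)
    assume "j \<noteq> k"
    then have "g j \<noteq> g k"
      using g_inj jk by (auto simp: inj_on_def)
    then obtain i where "g j i \<noteq> g k i"
      by blast
    then have ge1: "1 \<le> \<bar>real (g j i) - real (g k i)\<bar>"
      by linarith
    have diff: "\<gamma> j i - \<gamma> k i = (real (g j i) - real (g k i)) * (2 * q)"
      by (simp add: \<gamma>_def algebra_simps)
    have "1 * (2 * q) \<le> \<bar>real (g j i) - real (g k i)\<bar> * (2 * q)"
      using q ge1 by (intro mult_right_mono) auto
    also have "\<dots> = \<bar>\<gamma> j i - \<gamma> k i\<bar>"
      unfolding diff using q by (simp add: abs_mult)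
    also have "\<dots> \<le> \<bar>w i \<bullet> p - \<gamma> j i\<bar> + \<bar>w i \<bullet> p - \<gamma> k i\<bar>"
      by linarith
    also have "\<dots> \<le> \<rho> + \<rho>"
      using p by (intro add_mono) (auto simp: \<psi>_def box_gauge_le_iff oriented_box_def)
    finally show False
      using \<rho> by simp
  qed
  define i0 :: 'd where "i0 = undefined"
  \<comment> \<open>The outer cube is closed, so dividing by \<open>l2\<close> would allow the value
    1; the added 1 keeps \<open>h\<close> strictly below the last cut.\<close>
  define h where "h = (\<lambda>p. (w i0 \<bullet> p - (\<eta> i0 - l2 / 2)) / (l2 + 1))"
  have h: "0 \<le> h p \<and> h p < 1" if "p \<in> K \<epsilon>" for p
  proof -
    have "p \<in> oriented_box w \<eta> (l2 / 2)"
      using that B2 by (auto simp: K)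
    then have "\<bar>w i0 \<bullet> p - \<eta> i0\<bar> \<le> l2 / 2"
      by (auto simp: oriented_box_def)
    then have "0 \<le> w i0 \<bullet> p - (\<eta> i0 - l2 / 2)" "w i0 \<bullet> p - (\<eta> i0 - l2 / 2) < l2 + 1"
      by linarith+
    then show ?thesis
      using l2 by (simp add: h_def)
  qed
  have null_h: "AE p in lborel. h p \<noteq> t" for t
    using AE_inner_neq[OF w0, of i0 "t * (l2 + 1) + (\<eta> i0 - l2 / 2)"]
    by eventually_elim (use l2 in \<open>auto simp: h_def\<close>)
  have "\<exists>X. (\<forall>j<n. X j \<in> sets borel) \<and>
    (\<forall>i<n. \<forall>j<n. i \<noteq> j \<longrightarrow> X i \<inter> X j = {}) \<and>
    (\<forall>j<n. \<exists>k<n. (\<exists>r. 0 < r \<and> r \<le> \<rho> \<and> X j = {p. \<psi> k p \<le> r}) \<or>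
        {p. \<psi> k p \<le> \<rho>} \<subseteq> X j \<and> X j \<subseteq> {p. \<psi> k p \<le> \<rho>} \<union> K \<epsilon>) \<and>
    (\<forall>i<n. \<forall>j<n. (LINT p:X j|lborel. f i p) \<le> (LINT p:X i|lborel. f i p)) \<and>
    (\<forall>i<n. (LINT p:K \<epsilon>|lborel. f i p) / n \<le> (LINT p:X i|lborel. f i p))"
  proof (rule envy_free_sliced_partition[OF n(1) f(1,2)])
    show "\<psi> k \<in> borel_measurable borel" for k
      unfolding \<psi>_def by (rule borel_measurable_box_gauge)
    show "h \<in> borel_measurable borel"
      unfolding h_def by measurable
    show "K \<epsilon> \<in> sets borel"
      unfolding K B_def by (intro sets.Int C(1)) (intro borel_closed closed_INT ballI closed_oriented_box)
    show "AE p in lborel. \<psi> k p \<noteq> t" for k t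
      unfolding \<psi>_def by (rule AE_box_gauge_neq[OF w0])
    show "0 \<le> \<psi> k p" for k p
      by (simp add: \<psi>_def box_gauge_nonneg)
    show "0 < (LINT p:K \<epsilon>|lborel. f i p)" if "i < n" for i
      using big[OF that] c val_pos[OF that] by (smt (verit) mult_pos_pos)
  qed (use h null_h \<rho> disj in auto)
  then obtain X where "\<forall>j<n. X j \<in> sets borel" "\<forall>i<n. \<forall>j<n. i \<noteq> j \<longrightarrow> X i \<inter> X j = {}"
    "\<forall>j<n. \<exists>k<n. (\<exists>r. 0 < r \<and> r \<le> \<rho> \<and> X j = oriented_box w (\<gamma> k) r) \<or>
        oriented_box w (\<gamma> k) \<rho> \<subseteq> X j \<and> X j \<subseteq> oriented_box w (\<gamma> k) \<rho> \<union> K \<epsilon>"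
    "\<forall>i<n. \<forall>j<n. (LINT p:X j|lborel. f i p) \<le> (LINT p:X i|lborel. f i p)"
    "\<forall>i<n. (LINT p:K \<epsilon>|lborel. f i p) / n \<le> (LINT p:X i|lborel. f i p)"
    unfolding \<psi> by (elim exE conjE) (rule that)
  note X = this(1,2)[rule_format] and shape = this(3)[rule_format]
    and best = this(4)[rule_format] and share = this(5)[rule_format]
  have XC: "X j \<subseteq> C" if j: "j < n" for j
  proof -
    obtain k where k: "k < n" and "(\<exists>r\<le>\<rho>. X j = oriented_box w (\<gamma> k) r) \<or> X j \<subseteq> oriented_box w (\<gamma> k) \<rho> \<union> K \<epsilon>"
      using shape[OF j] by blast
    then show ?thesis
      using seed_C[OF k] seed_C[OF k order_refl] by (auto simp: K)
  qed
  have X_fat: "fat (real m * R) (X j)" if j: "j < n" for j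
  proof -
    obtain k where k: "k < n" and "(\<exists>r. 0 < r \<and> r \<le> \<rho> \<and> X j = oriented_box w (\<gamma> k) r) \<or>
        oriented_box w (\<gamma> k) \<rho> \<subseteq> X j \<and> X j \<subseteq> oriented_box w (\<gamma> k) \<rho> \<union> K \<epsilon>"
      using shape[OF j] by blast
    then show ?thesis
    proof (elim disjE exE conjE)
      fix r assume r: "0 < r" "X j = oriented_box w (\<gamma> k) r"
      have "1 * 1 \<le> real m * R"
        using m R by (intro mult_mono) auto
      then show ?thesis
        using r unfolding w_def by (intro fat_oriented_boxI[OF Q, of r "\<gamma> k" _ "\<gamma> k" r]) auto
    next
      assume X: "oriented_box w (\<gamma> k) \<rho> \<subseteq> X j" "X j \<subseteq> oriented_box w (\<gamma> k) \<rho> \<union> K \<epsilon>"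
      \<comment> \<open>The seed of cell \<open>k\<close> and all of \<open>K \<epsilon>\<close> lie
        in \<open>B k\<close>. In the ratio of the sides \<open>1 - \<epsilon>\<close> cancels, and
        \<open>m\<close> appears because a cell has side \<open>l1 / m\<close>.\<close>
      have "X j \<subseteq> B k"
        using X(2) seed_B[OF k] k by (auto simp: K)
      moreover have "(1 - \<epsilon>) * (l2 / 2) / \<rho> = m * (l2 / l1)"
        using \<epsilon> l1 m by (simp add: \<rho>_def q_def field_simps)
      then have "(1 - \<epsilon>) * (l2 / 2) / \<rho> \<le> m * R"
        using ratio by (simp only: mult_left_mono of_nat_0_le_iff)
      ultimately show ?thesis
        using fat_oriented_boxI[OF Q \<rho>(1)] X(1) unfolding w_def B_def by blast
    qed
  qed
  have XS: "X j \<in> S" if "j < n" for j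
    using X(1) X_fat that by (simp add: S_def)
  have valX: "val (v i) (X j) = (LINT p:X j|lborel. f i p)" "valS S (v i) (X j) = (LINT p:X j|lborel. f i p)"
    if "i < n" "j < n" for i j
    using f(3)[OF that(1) XC[OF that(2)]] valS_eq_val[OF v[OF that(1)] _ XS[OF that(2)] XC[OF that(2)]]
    by (auto simp: S_def)
  have "S_allocation C n S X"
    unfolding S_allocation_def using XS X(2) by (intro conjI UN_least XC) auto
  moreover have "envy_free n S v X"
    using best by (simp add: envy_free_def valX)
  moreover have "c * val (v i) C / n \<le> val (v i) (X i)" if i: "i < n" for i
  proof -
    have "c * val (v i) C / n \<le> (LINT p:K \<epsilon>|lborel. f i p) / n"
      using big[OF i] by (intro divide_right_mono) auto
    then show ?thesis
      using share[OF i] by (simp add: valX i)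
  qed
  ultimately show ?thesis
    by blast
qed

section \<open>The upper bound and the exact value\<close>

lemma fat_measure_pos:
  fixes C :: "(real^'d) set"
  assumes "fat R C" "bounded C" "C \<in> sets borel"
  shows "0 < measure lborel C"
proof -
  obtain Q a b l1 l2 where Q: "orthogonal_transformation Q" and l1: "0 < l1"
    and sub1: "cube Q a l1 \<subseteq> C"
    using assms unfolding fat_def by blast
  define z where "z = a + Q (\<chi> i. l1 / 2)"
  \<comment> \<open>The vectors \<open>Q (axis i 1)\<close> have norm 1, so by Cauchy-Schwarz no
    frame coordinate differs from that of the centre by more than the distance to it.\<close>
  have "ball z (l1 / 2) \<subseteq> cube Q a l1"
  proof
    fix p assume p: "p \<in> ball z (l1 / 2)"
    have "\<bar>Q (axis i 1) \<bullet> p - (Q (axis i 1) \<bullet> a + l1 / 2)\<bar> \<le> l1 / 2" for i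
    proof -
      have "Q (axis i 1) \<bullet> Q (\<chi> i. l1 / 2) = l1 / 2"
        using Q by (simp add: orthogonal_transformation_def inner_axis')
      then have "Q (axis i 1) \<bullet> p - (Q (axis i 1) \<bullet> a + l1 / 2) = Q (axis i 1) \<bullet> (p - z)"
        by (simp add: z_def inner_diff_right inner_add_right)
      also have "\<bar>\<dots>\<bar> \<le> norm (Q (axis i 1)) * norm (p - z)"
        by (rule Cauchy_Schwarz_ineq2)
      also have "\<dots> \<le> l1 / 2"
        using p orthogonal_transformation_norm[OF Q, of "axis i 1"]
        by (simp add: dist_norm norm_minus_commute)
      finally show ?thesis .
    qed
    then show "p \<in> cube Q a l1"
      unfolding cube_eq_oriented_box[OF Q] oriented_box_def by blast
  qed
  then have "ball z (l1 / 2) \<subseteq> C"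
    using sub1 by blast
  then have "measure lborel (ball z (l1 / 2)) \<le> measure lborel C"
    using assms emeasure_bounded_finite[of C] by (intro measure_mono_fmeasurable) (auto simp: fmeasurable_def)
  moreover have "0 < measure lborel (ball z (l1 / 2))"
    using l1 content_ball_pos[of "l1 / 2" z] by simp
  ultimately show ?thesis
    by linarith
qed

theorem theorem2:
  fixes C :: "(real^'d) set" and R :: real and n :: nat
  assumes "CARD('d) \<ge> 2" and "R \<ge> 1" and "n \<ge> 2"
    and "C \<in> sets borel" and "bounded C" and "fat R C"
  shows "PropEF C n {X. X \<in> sets borel \<and>
            fat (real (nat \<lceil>real n powr (1 / real CARD('d))\<rceil>) * R) X} = ereal (1 / real n)"
proof (rule antisym)
  define m where "m = nat \<lceil>real n powr (1 / real CARD('d))\<rceil>"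
  define S where "S = {X. X \<in> sets borel \<and> fat (real m * R) (X :: (real^'d) set)}"
  have n: "0 < n"
    using assms by simp
  have nm: "n \<le> m ^ CARD('d)"
    unfolding m_def using n by (intro le_root_ceiling_power) auto
  have val_one: "val (\<lambda>_. 1) X = measure lborel X" if "X \<in> sets borel" for X :: "(real^'d) set"
    using that by (simp add: val_def set_lebesgue_integral_def)
  have C_pos: "0 < measure lborel C"
    using assms by (intro fat_measure_pos)
  have C_fin: "emeasure lborel C < \<infinity>"
    using emeasure_bounded_finite[OF assms(5)] by simp
  have v1: "value_measure C (\<lambda>_. 1)"
    using C_pos C_fin assms(4) val_one[OF assms(4)] unfolding value_measure_def
    by (auto simp: set_integrable_def intro!: integrable_real_indicator exI[of _ 1])
  show "PropEF C n {X. X \<in> sets borel \<and> fat (real m * R) X} \<le> ereal (1 / real n)"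
    unfolding PropEF_def S_def[symmetric]
  proof (rule INF_lower2[of "\<lambda>_ _. 1"])
    show "(\<lambda>_ _. 1) \<in> {v. \<forall>i<n. value_measure C (v i)}"
      using v1 by simp
    show "(SUP X\<in>{X. S_allocation C n S X \<and> envy_free n S (\<lambda>_ _. 1) X}.
        ereal (Min ((\<lambda>i. val (\<lambda>_. 1) (X i) / val (\<lambda>_. 1) C) ` {..<n}))) \<le> ereal (1 / real n)"
    proof (rule SUP_least)
      fix X assume "X \<in> {X. S_allocation C n S X \<and> envy_free n S (\<lambda>_ _. 1) X}"
      then have X: "S_allocation C n S X"
        by simp
      have meas: "X i \<in> sets borel" if "i < n" for i
        using X that by (auto simp: S_allocation_def S_def)
      define \<mu> where "\<mu> = Min ((\<lambda>i. val (\<lambda>_. 1) (X i) / val (\<lambda>_. 1) C) ` {..<n})"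
      have le: "\<mu> \<le> measure lborel (X i) / measure lborel C" if "i < n" for i
      proof -
        have "\<mu> \<le> val (\<lambda>_. 1) (X i) / val (\<lambda>_. 1) C"
          unfolding \<mu>_def using that by (intro Min_le) auto
        then show ?thesis
          by (simp add: val_one meas that assms(4))
      qed
      have XC: "X i \<subseteq> C" if "i < n" for i
        using X that by (auto simp: S_allocation_def)
      have fin: "emeasure lborel (X i) \<noteq> \<infinity>" if "i < n" for i
        using emeasure_mono[OF XC[OF that], of lborel] C_fin assms(4) by auto
      have "n * \<mu> = (\<Sum>i<n. \<mu>)"
        by simp
      also have "\<dots> \<le> (\<Sum>i<n. measure lborel (X i) / measure lborel C)"
        using le by (intro sum_mono) simp
      also have "\<dots> = (\<Sum>i<n. measure lborel (X i)) / measure lborel C"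
        by (simp add: sum_divide_distrib)
      also have "(\<Sum>i<n. measure lborel (X i)) = measure lborel (\<Union>i<n. X i)"
        using meas fin X
        by (intro measure_finite_Union[symmetric]) (auto simp: disjoint_family_on_def S_allocation_def)
      also have "\<dots> \<le> measure lborel C"
        using meas XC C_fin assms(4) by (intro measure_mono_fmeasurable) (auto simp: fmeasurable_def)
      finally have "n * \<mu> \<le> 1"
        using C_pos by (simp add: divide_right_mono)
      then have "\<mu> \<le> 1 / n"
        using n by (simp add: field_simps)
      then show "ereal (Min ((\<lambda>i. val (\<lambda>_. 1) (X i) / val (\<lambda>_. 1) C) ` {..<n})) \<le> ereal (1 / real n)"
        by (simp add: \<mu>_def)
    qed
  qed
  show "ereal (1 / real n) \<le> PropEF C n {X. X \<in> sets borel \<and> fat (real m * R) X}"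
    unfolding PropEF_def S_def[symmetric]
  \<comment> \<open>The supremum is handled through its real upper bounds \<open>z\<close>, because
    allocations are at hand only for each \<open>c < 1\<close>; letting \<open>c\<close> tend to 1
    bounds \<open>z\<close> from below.\<close>
  proof (rule INF_greatest, rule ereal_le_real)
    fix v z
    assume "v \<in> {v. \<forall>i<n. value_measure C (v i)}"
    then have v: "\<And>i. i < n \<Longrightarrow> value_measure C (v i)"
      by simp
    assume z: "(SUP X\<in>{X. S_allocation C n S X \<and> envy_free n S v X}.
        ereal (Min ((\<lambda>i. val (v i) (X i) / val (v i) C) ` {..<n}))) \<le> ereal z"
    have "c * (1 / n) \<le> z" if c: "0 < c" "c < 1" for c
    proof -
      obtain X where X: "S_allocation C n S X" "envy_free n S v X"
        and share: "\<And>i. i < n \<Longrightarrow> c * val (v i) C / n \<le> val (v i) (X i)"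
        using near_proportional_envy_free_allocation[where v = v, OF n nm assms(2,4,6) v c]
        unfolding S_def by blast
      have "c * (1 / n) \<le> val (v i) (X i) / val (v i) C" if "i < n" for i
        using share[OF that] v[OF that] n by (simp add: value_measure_def field_simps)
      then have "c * (1 / n) \<le> Min ((\<lambda>i. val (v i) (X i) / val (v i) C) ` {..<n})"
        using n by (subst Min_ge_iff) auto
      moreover have "ereal (Min ((\<lambda>i. val (v i) (X i) / val (v i) C) ` {..<n})) \<le> ereal z"
        using X by (intro order_trans[OF SUP_upper z]) simp
      ultimately show ?thesis
        by simp
    qed
    then show "ereal (1 / real n) \<le> ereal z"
      using field_le_mult_one_interval[of "1 / n" z] by simp
  qed
qed

end
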